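(* Let $X$ be a complex Banach space with the bounded approximation property. Let $\varphi\in\mathcal G_0(B_X)$ be multiplicative. Then there is some $x_0\in\overline{B}_X$ such that $\varphi=\delta(x_0)$.
   Context: $B_X$ is the open unit ball of $X$ and $\overline{B}_X$ the closed unit ball. $\mathcal{H}L_0(B_X)$ is the Banach space of all holomorphic Lipschitz functions $f\colon B_X\to\mathbb C$ with $f(0)=0$, normed by the Lipschitz constant $L(f)$; it is an algebra under pointwise product. Every such $f$ extends uniquely to a Lipschitz function on $\overline{B}_X$, still denoted $f$. For $x\in\overline{B}_X$, $\delta(x)\in\mathcal{H}L_0(B_X)^*$ is the evaluation $f\mapsto f(x)$. $\mathcal G_0(B_X)$ is the norm-closed linear span of $\{\delta(x):x\in B_X\}$ in $\mathcal{H}L_0(B_X)^*$. An element $\varphi\in\mathcal{H}L_0(B_X)^*$ is multiplicative if $\varphi(fg)=\varphi(f)\varphi(g)$ for all $f,g\in\mathcal{H}L_0(B_X)$ (the zero functional is allowed). $X$ has the bounded approximation property if there is $\lambda>0$ such that the identity of $X$ can be approximated, uniformly on compact sets, by finite-rank operators of norm at most $\lambda$. *)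

theory Defs
  imports "HOL-Analysis.Analysis"
begin

section \<open>Complex normed spaces\<close>

text \<open>
  The distribution only has real normed spaces as a type class. A complex normed space is a real
  normed space with a compatible complex scalar multiplication, and a complex Banach space is a
  complete one.
\<close>

class complex_normed_vector = real_normed_vector +
  fixes scaleC :: "complex \<Rightarrow> 'a \<Rightarrow> 'a"  (infixr \<open>*\<^sub>C\<close> 75)
  assumes scaleC_add_right: "a *\<^sub>C (x + y) = a *\<^sub>C x + a *\<^sub>C y"
    and scaleC_add_left: "(a + b) *\<^sub>C x = a *\<^sub>C x + b *\<^sub>C x"
    and scaleC_scaleC: "a *\<^sub>C (b *\<^sub>C x) = (a * b) *\<^sub>C x"
    and scaleC_of_real: "complex_of_real r *\<^sub>C x = r *\<^sub>R x"
    and norm_scaleC: "norm (a *\<^sub>C x) = cmod a * norm x"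

class cbanach = complex_normed_vector + banach

lemma scaleC_one: "1 *\<^sub>C x = (x :: 'a :: complex_normed_vector)"
  using scaleC_of_real[of 1 x] by simp

global_interpretation complex_vector:
  vector_space "scaleC :: complex \<Rightarrow> 'a \<Rightarrow> 'a :: complex_normed_vector"
  defines cspan = complex_vector.span
  by standard (simp_all add: scaleC_add_right scaleC_add_left scaleC_scaleC scaleC_one)

abbreviation clinear :: "('a :: complex_normed_vector \<Rightarrow> 'b :: complex_normed_vector) \<Rightarrow> bool"
  where "clinear \<equiv> Vector_Spaces.linear scaleC scaleC"

lemma clinear_iff:
  "clinear f \<longleftrightarrow> (\<forall>x y. f (x + y) = f x + f y) \<and> (\<forall>c x. f (c *\<^sub>C x) = c *\<^sub>C f x)"
  by (simp add: linear_iff_module_hom module_hom_iff complex_vector.module_axioms)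

lemma clinear_compose_add:
  "clinear f \<Longrightarrow> clinear g \<Longrightarrow> clinear (\<lambda>x. f x + g x)"
  by (auto simp: clinear_iff scaleC_add_right)

lemma clinear_compose_scale: "clinear f \<Longrightarrow> clinear (\<lambda>x. c *\<^sub>C f x)"
  by (auto simp: clinear_iff scaleC_add_right scaleC_scaleC mult.commute)

lemma bounded_linear_scaleC: "bounded_linear (\<lambda>x :: 'a :: complex_normed_vector. c *\<^sub>C x)"
proof (rule bounded_linear_intro[where K = "cmod c"])
  fix r and x :: 'a
  show "c *\<^sub>C r *\<^sub>R x = r *\<^sub>R c *\<^sub>C x"
    by (simp only: scaleC_of_real[symmetric] scaleC_scaleC mult.commute)
qed (simp_all add: scaleC_add_right norm_scaleC mult.commute)

instantiation complex :: cbanach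
begin

definition scaleC_complex :: "complex \<Rightarrow> complex \<Rightarrow> complex"
  where "scaleC_complex a z = a * z"

instance
  by standard (simp_all add: scaleC_complex_def algebra_simps scaleR_conv_of_real norm_mult)

end

lemma onorm_scaleC_le:
  fixes f :: "'a :: real_normed_vector \<Rightarrow> 'b :: complex_normed_vector"
  assumes "bounded_linear f"
  shows "onorm (\<lambda>x. c *\<^sub>C f x) \<le> cmod c * onorm f"
proof (rule onorm_bound)
  fix x
  show "norm (c *\<^sub>C f x) \<le> cmod c * onorm f * norm x"
    using mult_left_mono[OF onorm[OF assms, of x], of "cmod c"]
    by (simp add: norm_scaleC mult.assoc)
qed (simp add: onorm_pos_le[OF assms])

lemma onorm_scaleC:
  fixes f :: "'a :: real_normed_vector \<Rightarrow> 'b :: complex_normed_vector"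
  assumes f: "bounded_linear f"
  shows "onorm (\<lambda>x. c *\<^sub>C f x) = cmod c * onorm f"
proof (cases "c = 0")
  case True
  then show ?thesis by (simp add: complex_vector.scale_zero_left onorm_zero)
next
  case False
  have "bounded_linear (\<lambda>x. c *\<^sub>C f x)"
    using bounded_linear_scaleC f by (rule bounded_linear_compose)
  then have "onorm (\<lambda>x. inverse c *\<^sub>C c *\<^sub>C f x) \<le> cmod (inverse c) * onorm (\<lambda>x. c *\<^sub>C f x)"
    by (rule onorm_scaleC_le)
  then have "cmod c * onorm f \<le> onorm (\<lambda>x. c *\<^sub>C f x)"
    using False
    by (simp add: scaleC_scaleC scaleC_one norm_inverse norm_divide field_simps)
  then show ?thesis using onorm_scaleC_le[OF f, of c] by simp
qed

instantiation blinfun :: (real_normed_vector, complex_normed_vector) complex_normed_vector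
begin

lift_definition scaleC_blinfun :: "complex \<Rightarrow> 'a \<Rightarrow>\<^sub>L 'b \<Rightarrow> 'a \<Rightarrow>\<^sub>L 'b" is "\<lambda>c f x. c *\<^sub>C f x"
  using bounded_linear_compose[OF bounded_linear_scaleC] .

instance
  by standard
    (transfer, simp add: scaleC_add_right scaleC_add_left scaleC_scaleC scaleC_of_real onorm_scaleC)+

end

instance blinfun :: (real_normed_vector, cbanach) cbanach ..

text \<open>
  Compact sets are norm compact; approximating operators are bounded complex-linear operators
  whose range is contained in a finite-dimensional complex subspace.
\<close>

definition bounded_approximation_property :: "'a :: cbanach itself \<Rightarrow> bool" where
  "bounded_approximation_property (_ :: 'a itself) \<longleftrightarrow>
    (\<exists>M>0. \<forall>K :: 'a set. compact K \<longrightarrow> (\<forall>\<epsilon>>0. \<exists>T :: 'a \<Rightarrow>\<^sub>L 'a.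
        clinear (blinfun_apply T) \<and>
        (\<exists>B. finite B \<and> range (blinfun_apply T) \<subseteq> cspan B) \<and>
        norm T \<le> M \<and>
        (\<forall>x\<in>K. norm (blinfun_apply T x - x) < \<epsilon>)))"

section \<open>Holomorphic Lipschitz functions on the unit ball\<close>

text \<open>Holomorphy on an open set is complex Frechet differentiability at every point.\<close>

definition frechet_holomorphic_on ::
    "('a :: complex_normed_vector \<Rightarrow> complex) \<Rightarrow> 'a set \<Rightarrow> bool"  (infixl \<open>frechet'_holomorphic'_on\<close> 50)
  where "f frechet_holomorphic_on U \<longleftrightarrow>
    (\<forall>x\<in>U. \<exists>f'. (f has_derivative f') (at x) \<and> clinear f')"

text \<open>
  A function on the open unit ball is encoded as a total function that vanishes off the ball, so
  that equality of representatives is equality on the ball. The value of the Lipschitz extension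
  to the closed ball at boundary points is given separately by \<open>HL0_ext\<close> below.
\<close>

definition HL0_carrier :: "('a :: complex_normed_vector \<Rightarrow> complex) set" where
  "HL0_carrier = {f. f frechet_holomorphic_on ball 0 1 \<and> (\<exists>C. C-lipschitz_on (ball 0 1) f) \<and>
     f 0 = 0 \<and> (\<forall>x. x \<notin> ball 0 1 \<longrightarrow> f x = 0)}"

lemma HL0_carrier_zero: "(\<lambda>x. 0) \<in> HL0_carrier"
  unfolding HL0_carrier_def frechet_holomorphic_on_def
  by (auto intro!: exI[of _ "\<lambda>x. 0"] exI[of _ 0] lipschitz_on_constant
      simp: clinear_iff scaleC_complex_def)

lemma HL0_carrier_add:
  assumes "f \<in> HL0_carrier" "g \<in> HL0_carrier"
  shows "(\<lambda>x. f x + g x) \<in> HL0_carrier"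
proof -
  have "(\<lambda>x. f x + g x) frechet_holomorphic_on ball 0 1"
    using assms unfolding HL0_carrier_def frechet_holomorphic_on_def
    by (blast intro: has_derivative_add clinear_compose_add)
  then show ?thesis
    using assms unfolding HL0_carrier_def by (auto intro: lipschitz_on_add)
qed

lemma HL0_carrier_scaleC:
  assumes "f \<in> HL0_carrier"
  shows "(\<lambda>x. c *\<^sub>C f x) \<in> HL0_carrier"
proof -
  have "(\<lambda>x. c *\<^sub>C f x) frechet_holomorphic_on ball 0 1"
    using assms unfolding HL0_carrier_def frechet_holomorphic_on_def
    by (blast intro: bounded_linear.has_derivative[OF bounded_linear_scaleC] clinear_compose_scale)
  moreover have "(cmod c * C)-lipschitz_on (ball 0 1) (\<lambda>x. c *\<^sub>C f x)"
    if "C-lipschitz_on (ball 0 1) f" for C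
    using that unfolding lipschitz_on_def dist_norm scaleC_complex_def
    by (auto simp: norm_mult mult.assoc simp flip: right_diff_distrib intro: mult_left_mono)
  ultimately show ?thesis
    using assms unfolding HL0_carrier_def by (auto simp: scaleC_complex_def)
qed

lemma HL0_carrier_bound:
  fixes f :: "'a :: real_normed_vector \<Rightarrow> complex"
  assumes "f 0 = 0" "C-lipschitz_on (ball 0 1) f" "x \<in> ball 0 1"
  shows "cmod (f x) \<le> C"
proof -
  have "cmod (f x) \<le> C * norm x"
    using lipschitz_on_normD[OF assms(2,3), of 0] assms(1) by simp
  also have "\<dots> \<le> C"
    using assms(3) lipschitz_on_nonneg[OF assms(2)] by (simp add: mult_left_le)
  finally show ?thesis .
qed

lemma HL0_carrier_mult:
  assumes "f \<in> HL0_carrier" "g \<in> HL0_carrier"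
  shows "(\<lambda>x. f x * g x) \<in> HL0_carrier"
proof -
  have "(\<lambda>x. f x * g x) frechet_holomorphic_on ball 0 1"
    unfolding frechet_holomorphic_on_def
  proof
    fix x :: 'a assume x: "x \<in> ball 0 1"
    obtain f' g' where "(f has_derivative f') (at x)" "clinear f'"
      "(g has_derivative g') (at x)" "clinear g'"
      using assms x unfolding HL0_carrier_def frechet_holomorphic_on_def by blast
    then have "((\<lambda>x. f x * g x) has_derivative (\<lambda>h. f x * g' h + f' h * g x)) (at x)"
      and "clinear (\<lambda>h. f x * g' h + f' h * g x)"
      by (auto intro: has_derivative_mult simp: clinear_iff scaleC_complex_def algebra_simps)
    then show "\<exists>f'. ((\<lambda>x. f x * g x) has_derivative f') (at x) \<and> clinear f'" by blast
  qed
  moreover obtain C D where C: "C-lipschitz_on (ball 0 1) f" and D: "D-lipschitz_on (ball 0 1) g"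
    using assms unfolding HL0_carrier_def by blast
  have "(2 * C * D)-lipschitz_on (ball 0 1) (\<lambda>x. f x * g x)"
  proof (rule lipschitz_onI)
    fix x y :: 'a assume x: "x \<in> ball 0 1" and y: "y \<in> ball 0 1"
    have 0: "f 0 = 0" "g 0 = 0" using assms by (auto simp: HL0_carrier_def)
    have "cmod (f x * g x - f y * g y) = cmod (f x * (g x - g y) + (f x - f y) * g y)"
      by (simp add: algebra_simps)
    also have "\<dots> \<le> cmod (f x) * cmod (g x - g y) + cmod (f x - f y) * cmod (g y)"
      using norm_triangle_ineq by (metis norm_mult)
    also have "\<dots> \<le> C * (D * norm (x - y)) + (C * norm (x - y)) * D"
      using HL0_carrier_bound[OF 0(1) C x] HL0_carrier_bound[OF 0(2) D y]
        lipschitz_on_normD[OF C x y] lipschitz_on_normD[OF D x y]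
        lipschitz_on_nonneg[OF C] lipschitz_on_nonneg[OF D]
      by (intro add_mono mult_mono) auto
    finally show "dist (f x * g x) (f y * g y) \<le> 2 * C * D * dist x y"
      by (simp add: dist_norm algebra_simps)
  qed (use lipschitz_on_nonneg[OF C] lipschitz_on_nonneg[OF D] in simp)
  ultimately show ?thesis
    using assms unfolding HL0_carrier_def by auto
qed

lemma HL0_carrier_uminus: "f \<in> HL0_carrier \<Longrightarrow> (\<lambda>x. - f x) \<in> HL0_carrier"
  using HL0_carrier_scaleC[of f "-1"] by (simp add: scaleC_complex_def)

lemma HL0_carrier_diff:
  "f \<in> HL0_carrier \<Longrightarrow> g \<in> HL0_carrier \<Longrightarrow> (\<lambda>x. f x - g x) \<in> HL0_carrier"
  using HL0_carrier_add[OF _ HL0_carrier_uminus, of f g] by simp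

text \<open>
  The least Lipschitz constant on the ball. For the trivial space this is \<open>0\<close>.
\<close>

definition lipschitz_constant :: "('a :: real_normed_vector \<Rightarrow> complex) \<Rightarrow> real" where
  "lipschitz_constant f = Inf {C. C-lipschitz_on (ball 0 1) f}"

lemma lipschitz_constant_le: "C-lipschitz_on (ball 0 1) f \<Longrightarrow> lipschitz_constant f \<le> C"
  unfolding lipschitz_constant_def
  by (rule cInf_lower) (auto intro!: bdd_belowI[of _ 0] dest: lipschitz_on_nonneg)

lemma lipschitz_on_lipschitz_constant:
  fixes f :: "'a :: real_normed_vector \<Rightarrow> complex"
  assumes "C-lipschitz_on (ball 0 1) f"
  shows "(lipschitz_constant f)-lipschitz_on (ball 0 1) f"
proof (rule lipschitz_onI)
  let ?S = "{C. C-lipschitz_on (ball 0 1) f}"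
  have ne: "?S \<noteq> {}" using assms by auto
  show "0 \<le> lipschitz_constant f"
    unfolding lipschitz_constant_def using ne by (rule cInf_greatest) (auto dest: lipschitz_on_nonneg)
  fix x y :: 'a assume xy: "x \<in> ball 0 1" "y \<in> ball 0 1"
  show "dist (f x) (f y) \<le> lipschitz_constant f * dist x y"
  proof (cases "x = y")
    case False
    have "dist (f x) (f y) / dist x y \<le> lipschitz_constant f"
      unfolding lipschitz_constant_def using ne
    proof (rule cInf_greatest)
      fix C assume "C \<in> ?S"
      then have "dist (f x) (f y) \<le> C * dist x y" using xy by (auto dest: lipschitz_onD)
      then show "dist (f x) (f y) / dist x y \<le> C" using False by (simp add: pos_divide_le_eq)
    qed
    then show ?thesis using False by (simp add: pos_divide_le_eq)
  qed simp
qed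

typedef (overloaded) ('a :: complex_normed_vector) HL0 = "HL0_carrier :: ('a \<Rightarrow> complex) set"
  morphisms HL0_apply Abs_HL0
  using HL0_carrier_zero by blast

setup_lifting type_definition_HL0

lemma HL0_lipschitz: "(lipschitz_constant (HL0_apply f))-lipschitz_on (ball 0 1) (HL0_apply f)"
  using HL0_apply[of f] lipschitz_on_lipschitz_constant unfolding HL0_carrier_def by blast

instantiation HL0 :: (complex_normed_vector) complex_normed_vector
begin

lift_definition zero_HL0 :: "'a HL0" is "\<lambda>x. 0" by (rule HL0_carrier_zero)
lift_definition plus_HL0 :: "'a HL0 \<Rightarrow> 'a HL0 \<Rightarrow> 'a HL0" is "\<lambda>f g x. f x + g x"
  by (rule HL0_carrier_add)
lift_definition minus_HL0 :: "'a HL0 \<Rightarrow> 'a HL0 \<Rightarrow> 'a HL0" is "\<lambda>f g x. f x - g x"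
  by (rule HL0_carrier_diff)
lift_definition uminus_HL0 :: "'a HL0 \<Rightarrow> 'a HL0" is "\<lambda>f x. - f x"
  by (rule HL0_carrier_uminus)
lift_definition scaleC_HL0 :: "complex \<Rightarrow> 'a HL0 \<Rightarrow> 'a HL0" is "\<lambda>c f x. c *\<^sub>C f x"
  by (rule HL0_carrier_scaleC)
definition scaleR_HL0 :: "real \<Rightarrow> 'a HL0 \<Rightarrow> 'a HL0"
  where "scaleR_HL0 r f = complex_of_real r *\<^sub>C f"
lift_definition norm_HL0 :: "'a HL0 \<Rightarrow> real" is lipschitz_constant .
definition sgn_HL0 :: "'a HL0 \<Rightarrow> 'a HL0"
  where "sgn_HL0 f = inverse (norm f) *\<^sub>R f"
definition dist_HL0 :: "'a HL0 \<Rightarrow> 'a HL0 \<Rightarrow> real"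
  where "dist_HL0 f g = norm (f - g)"
definition [code del]:
  "(uniformity :: ('a HL0 \<times> 'a HL0) filter) = (INF e\<in>{0 <..}. principal {(x, y). dist x y < e})"
definition open_HL0 :: "'a HL0 set \<Rightarrow> bool"
  where [code del]: "open_HL0 S = (\<forall>x\<in>S. \<forall>\<^sub>F (x', y) in uniformity. x' = x \<longrightarrow> y \<in> S)"

lemma norm_scaleC_HL0_le: "norm (c *\<^sub>C f) \<le> cmod c * norm (f :: 'a HL0)"
proof -
  have "(cmod c * norm f)-lipschitz_on (ball 0 1) (HL0_apply (c *\<^sub>C f))"
    using HL0_lipschitz[of f] unfolding lipschitz_on_def dist_norm
    by (auto simp: scaleC_HL0.rep_eq norm_HL0.rep_eq scaleC_complex_def norm_mult mult.assoc
        simp flip: right_diff_distrib intro: mult_left_mono)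
  then show ?thesis by (simp add: norm_HL0.rep_eq lipschitz_constant_le)
qed

lemma norm_scaleC_HL0: "norm (c *\<^sub>C f) = cmod c * norm (f :: 'a HL0)"
proof (rule antisym)
  show "cmod c * norm f \<le> norm (c *\<^sub>C f)"
  proof (cases "c = 0")
    case True
    have "0 \<le> norm (c *\<^sub>C f)"
      using lipschitz_on_nonneg[OF HL0_lipschitz] by (simp add: norm_HL0.rep_eq)
    then show ?thesis using True by simp
  next
    case False
    have "inverse c *\<^sub>C c *\<^sub>C f = f"
      using False by transfer (simp add: scaleC_complex_def field_simps)
    then show ?thesis
      using norm_scaleC_HL0_le[of "inverse c" "c *\<^sub>C f"] False
      by (simp add: norm_inverse norm_divide field_simps)
  qed
qed (rule norm_scaleC_HL0_le)

instance
proof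
  fix f g h :: "'a HL0" and a b :: real and c d :: complex
  show "f + g + h = f + (g + h)" "f + g = g + f" "0 + f = f" "- f + f = 0" "f - g = f + - g"
    by (transfer; simp add: algebra_simps)+
  show "c *\<^sub>C (f + g) = c *\<^sub>C f + c *\<^sub>C g" "(c + d) *\<^sub>C f = c *\<^sub>C f + d *\<^sub>C f"
    "c *\<^sub>C d *\<^sub>C f = (c * d) *\<^sub>C f"
    by (transfer; simp add: scaleC_complex_def algebra_simps)+
  show "complex_of_real a *\<^sub>C f = a *\<^sub>R f" by (simp add: scaleR_HL0_def)
  show "a *\<^sub>R (f + g) = a *\<^sub>R f + a *\<^sub>R g" "(a + b) *\<^sub>R f = a *\<^sub>R f + b *\<^sub>R f"
    "a *\<^sub>R b *\<^sub>R f = (a * b) *\<^sub>R f" "1 *\<^sub>R f = f"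
    unfolding scaleR_HL0_def by (transfer; simp add: scaleC_complex_def algebra_simps)+
  show "norm (c *\<^sub>C f) = cmod c * norm f" by (rule norm_scaleC_HL0)
  show "norm (a *\<^sub>R f) = \<bar>a\<bar> * norm f" by (simp add: scaleR_HL0_def norm_scaleC_HL0)
  show "dist f g = norm (f - g)" by (rule dist_HL0_def)
  show "sgn f = inverse (norm f) *\<^sub>R f" by (rule sgn_HL0_def)
  show "(uniformity :: ('a HL0 \<times> 'a HL0) filter) = (INF e\<in>{0 <..}. principal {(x, y). dist x y < e})"
    by (rule uniformity_HL0_def)
  show "open U \<longleftrightarrow> (\<forall>x\<in>U. \<forall>\<^sub>F (x', y) in uniformity. x' = x \<longrightarrow> y \<in> U)" for U :: "'a HL0 set"
    by (rule open_HL0_def)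
  show "norm (f + g) \<le> norm f + norm g"
    using lipschitz_on_add[OF HL0_lipschitz[of f] HL0_lipschitz[of g]]
    by (simp add: norm_HL0.rep_eq plus_HL0.rep_eq lipschitz_constant_le)
  show "norm f = 0 \<longleftrightarrow> f = 0"
  proof
    assume 0: "norm f = 0"
    have "HL0_apply f x = 0" for x
    proof (cases "x \<in> ball 0 1")
      case True
      then show ?thesis
        using HL0_carrier_bound[OF _ HL0_lipschitz[of f] True] HL0_apply[of f] 0
        by (simp add: norm_HL0.rep_eq HL0_carrier_def)
    next
      case False
      then show ?thesis using HL0_apply[of f] by (simp add: HL0_carrier_def)
    qed
    then show "f = 0" by transfer auto
  next
    assume "f = 0"
    then have "norm f \<le> 0"
      by (simp add: norm_HL0.rep_eq zero_HL0.rep_eq lipschitz_constant_le lipschitz_on_constant)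
    moreover have "0 \<le> norm f"
      using lipschitz_on_nonneg[OF HL0_lipschitz] by (simp add: norm_HL0.rep_eq)
    ultimately show "norm f = 0" by simp
  qed
qed

end

instantiation HL0 :: (complex_normed_vector) times
begin
lift_definition times_HL0 :: "'a HL0 \<Rightarrow> 'a HL0 \<Rightarrow> 'a HL0" is "\<lambda>f g x. f x * g x"
  by (rule HL0_carrier_mult)
instance ..
end

section \<open>Evaluations and the predual\<close>

text \<open>
  The Lipschitz extension to the closed ball, by limits at boundary points (cf.\
  \<open>lipschitz_on_HL0_ext\<close> and \<open>HL0_ext_unique\<close>).
\<close>

definition HL0_ext :: "('a :: complex_normed_vector) HL0 \<Rightarrow> 'a \<Rightarrow> complex" where
  "HL0_ext f x = (if x \<in> ball 0 1 then HL0_apply f x else Lim (at x within ball 0 1) (HL0_apply f))"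

lemma HL0_ext_unique:
  fixes x :: "'a :: complex_normed_vector"
  assumes g: "C-lipschitz_on (cball 0 1) g" "\<forall>x\<in>ball 0 1. g x = HL0_apply f x" and x: "x \<in> cball 0 1"
  shows "HL0_ext f x = g x"
proof (cases "x \<in> ball 0 1")
  case True
  then show ?thesis using g by (simp add: HL0_ext_def)
next
  case False
  have "(g \<longlongrightarrow> g x) (at x within cball 0 1)"
    using lipschitz_on_continuous_on[OF g(1)] x by (auto simp: continuous_on_def)
  then have "(g \<longlongrightarrow> g x) (at x within ball 0 1)"
    by (rule tendsto_within_subset) auto
  moreover have "\<forall>\<^sub>F y in at x within ball 0 1. g y = HL0_apply f y"
    unfolding eventually_at_topological using g(2) by blast
  ultimately have lim: "(HL0_apply f \<longlongrightarrow> g x) (at x within ball 0 1)"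
    by (rule Lim_transform_eventually)
  have "x \<in> closure (ball 0 1)" using x by simp
  then have "at x within ball 0 1 \<noteq> bot"
    using False by (simp add: trivial_limit_within closure_def)
  then have "Lim (at x within ball 0 1) (HL0_apply f) = g x"
    using lim by (rule tendsto_Lim)
  then show ?thesis using False by (simp add: HL0_ext_def)
qed

lemma lipschitz_on_HL0_ext: "(norm f)-lipschitz_on (cball 0 1) (HL0_ext f)"
proof -
  obtain g where g: "(norm f)-lipschitz_on (closure (ball 0 1)) g" "\<forall>x\<in>ball 0 1. g x = HL0_apply f x"
    using lipschitz_extend_closure[OF HL0_lipschitz[of f]] by (auto simp: norm_HL0.rep_eq)
  then have g': "(norm f)-lipschitz_on (cball 0 1) g" by simp
  show ?thesis
    by (rule lipschitz_on_transform[OF g']) (rule HL0_ext_unique[OF g' g(2)])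
qed

definition delta :: "'a :: complex_normed_vector \<Rightarrow> 'a HL0 \<Rightarrow>\<^sub>L complex" where
  "delta x = Blinfun (\<lambda>f. HL0_ext f x)"

lemma HL0_ext_add: "x \<in> cball 0 1 \<Longrightarrow> HL0_ext (f + g) x = HL0_ext f x + HL0_ext g x"
  by (rule HL0_ext_unique[OF lipschitz_on_add[OF lipschitz_on_HL0_ext lipschitz_on_HL0_ext]])
    (auto simp: HL0_ext_def plus_HL0.rep_eq)

lemma HL0_ext_scaleC: "x \<in> cball 0 1 \<Longrightarrow> HL0_ext (c *\<^sub>C f) x = c *\<^sub>C HL0_ext f x"
proof (rule HL0_ext_unique[where C = "cmod c * norm f"])
  show "(cmod c * norm f)-lipschitz_on (cball 0 1) (\<lambda>x. c *\<^sub>C HL0_ext f x)"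
    using lipschitz_on_HL0_ext[of f] unfolding lipschitz_on_def dist_norm
    by (auto simp: scaleC_complex_def norm_mult mult.assoc
        simp flip: right_diff_distrib intro: mult_left_mono)
qed (auto simp: HL0_ext_def scaleC_HL0.rep_eq)

lemma norm_HL0_ext_le:
  assumes "x \<in> cball 0 1"
  shows "cmod (HL0_ext f x) \<le> norm f * norm x"
proof -
  have "HL0_ext f 0 = 0" using HL0_apply[of f] by (simp add: HL0_ext_def HL0_carrier_def)
  then show ?thesis using lipschitz_on_normD[OF lipschitz_on_HL0_ext[of f] assms, of 0] by simp
qed

lemma delta_apply:
  assumes "x \<in> cball 0 1"
  shows "blinfun_apply (delta x) f = HL0_ext f x"
proof -
  have "bounded_linear (\<lambda>f. HL0_ext f x)"
  proof (rule bounded_linear_intro[where K = "norm x"])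
    show "HL0_ext (r *\<^sub>R f) x = r *\<^sub>R HL0_ext f x" for r f
      using HL0_ext_scaleC[OF assms, of "complex_of_real r" f] by (simp add: scaleC_of_real)
  qed (use assms in \<open>simp_all add: HL0_ext_add norm_HL0_ext_le\<close>)
  then show ?thesis by (simp add: delta_def bounded_linear_Blinfun_apply)
qed

lemma delta_clinear: "x \<in> cball 0 1 \<Longrightarrow> clinear (blinfun_apply (delta x))"
  by (simp add: clinear_iff delta_apply HL0_ext_add HL0_ext_scaleC)

text \<open>
  The dual of \<open>'a HL0\<close> consists of the complex-linear elements of \<open>'a HL0 \<Rightarrow>\<^sub>L complex\<close>, with the
  operator norm. It is a closed complex subspace, so closures taken in \<open>'a HL0 \<Rightarrow>\<^sub>L complex\<close>
  of subsets of it stay inside (see \<open>G0_subset_HL0_dual\<close>).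
\<close>

definition HL0_dual :: "('a :: complex_normed_vector HL0 \<Rightarrow>\<^sub>L complex) set" where
  "HL0_dual = {\<phi>. clinear (blinfun_apply \<phi>)}"

definition G0 :: "('a :: complex_normed_vector HL0 \<Rightarrow>\<^sub>L complex) set" where
  "G0 = closure (cspan (delta ` ball 0 1))"

lemma closed_HL0_dual: "closed HL0_dual"
  unfolding HL0_dual_def clinear_iff scaleC_complex_def
  by (intro closed_Collect_conj closed_Collect_all closed_Collect_eq continuous_intros)

lemma G0_subset_HL0_dual: "G0 \<subseteq> (HL0_dual :: ('a :: complex_normed_vector HL0 \<Rightarrow>\<^sub>L complex) set)"
proof -
  let ?D = "HL0_dual :: ('a HL0 \<Rightarrow>\<^sub>L complex) set"
  have "complex_vector.subspace ?D"
    unfolding complex_vector.subspace_def HL0_dual_def clinear_iff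
    by (auto simp: plus_blinfun.rep_eq scaleC_blinfun.rep_eq scaleC_complex_def algebra_simps)
  moreover have "delta ` ball 0 1 \<subseteq> ?D"
    by (auto simp: HL0_dual_def intro: delta_clinear)
  ultimately have "cspan (delta ` ball 0 1) \<subseteq> ?D"
    by (intro complex_vector.span_minimal)
  then show ?thesis unfolding G0_def using closed_HL0_dual by (rule closure_minimal)
qed

definition multiplicative :: "('a :: complex_normed_vector HL0 \<Rightarrow>\<^sub>L complex) \<Rightarrow> bool" where
  "multiplicative \<phi> \<longleftrightarrow>
    (\<forall>f g. blinfun_apply \<phi> (f * g) = blinfun_apply \<phi> f * blinfun_apply \<phi> g)"

end

theory Submission
  imports Defs "HOL-Complex_Analysis.Complex_Analysis"
begin

text \<open>
  The candidate for \<open>x\<^sub>0\<close> is the barycentre of \<open>\<phi>\<close>: the point of the space, not merely of the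
  bidual, such that \<open>\<phi> u = u x\<^sub>0\<close> for every bounded linear functional \<open>u\<close>. It exists because a
  finite combination \<open>\<Sum>c\<^sub>i \<delta>(x\<^sub>i)\<close> acts on functionals as the point \<open>\<Sum>c\<^sub>i x\<^sub>i\<close>, and by Hahn-Banach
  (\<open>norming_functional\<close>) the norm of that point is at most the norm of the combination, so that
  norm limits of combinations have barycentres too (\<open>G0_barycenter\<close>). Multiplicativity puts \<open>x\<^sub>0\<close>
  into the closed ball: \<open>\<phi>(u\<^sup>n) = (u x\<^sub>0)\<^sup>n\<close>, whereas the Lipschitz constant of \<open>u\<^sup>n\<close> grows only
  linearly in \<open>n\<close>.

  It remains to see that \<open>\<phi>\<close> and \<open>\<delta>(x\<^sub>0)\<close> agree on every \<open>f\<close> and not only on functionals. Write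
  \<open>\<Phi>\<close> for the unital multiplicative extension of \<open>\<phi>\<close> to functions that need not vanish at the
  origin. Since \<open>\<phi>\<close> is a norm limit of combinations of evaluations, \<open>\<Phi>\<close> commutes with contour
  integrals over a parameter, preserves holomorphic dependence on a parameter, and on
  norm-bounded families is continuous for pointwise convergence (\<open>G0_eqI\<close>).

  Suppose first that \<open>f\<close> is composed with a small operator \<open>x \<mapsto> \<Sum>u\<^sub>i(x) b\<^sub>i\<close> of finite rank. In one
  variable, Cauchy's formula writes \<open>f(y + u(x) b)\<close> as an integral of \<open>f(y + \<lambda>b)/(\<lambda> - u(x))\<close>, and
  a unital multiplicative functional must send \<open>1/(\<lambda> - u)\<close> to \<open>1/(\<lambda> - u(x\<^sub>0))\<close>. Treating the
  variables one after another in this way (\<open>unital_extension_rank_sum\<close>) uses no power series in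
  several variables.

  For an arbitrary finite-rank operator \<open>T\<close>, the identity \<open>\<Phi>(f(\<zeta>T\<cdot>)) = f(\<zeta>Tx\<^sub>0)\<close> thus holds for
  small \<open>\<zeta>\<close>, and by analytic continuation whenever \<open>\<bar>\<zeta>\<bar>\<close> is less than the inverse of a bound for
  \<open>T\<close>. That disc is the same for all operators of norm at most \<open>M\<close>, so the bounded approximation
  property permits replacing \<open>T\<close> by the identity for \<open>\<bar>\<zeta>\<bar> < 1/M\<close>. A second analytic continuation
  extends \<open>\<Phi>(f(\<zeta>\<cdot>)) = f(\<zeta>x\<^sub>0)\<close> to the unit disc, and letting \<open>\<zeta>\<close> increase to 1 finishes the
  proof.
\<close>

section \<open>Norming functionals\<close>

definition sublinear :: "('a :: real_vector \<Rightarrow> real) \<Rightarrow> bool" where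
  "sublinear p \<longleftrightarrow> (\<forall>x y. p (x + y) \<le> p x + p y) \<and> (\<forall>t\<ge>0. \<forall>x. p (t *\<^sub>R x) = t * p x)"

lemma sublinear_minus_le:
  assumes "sublinear p"
  shows "- p (- x) \<le> p x"
proof -
  have "p (0 *\<^sub>R x) = 0 * p x" "p (x + - x) \<le> p x + p (- x)"
    using assms unfolding sublinear_def by blast+
  then show ?thesis by simp
qed

text \<open>
  Forcing a sublinear \<open>p\<close> to be as additive as possible in the direction \<open>y\<close>: the value at
  \<open>t = 0\<close> shows that the result lies below \<open>p\<close>, the value at \<open>t = 1\<close> that it is at most
  \<open>p (x + y) - p y\<close>. The tilt serves twice below: it shows that minimal sublinear functions are
  linear, and applied to the norm it forces a linear minorant to be norming at a given point.
\<close>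

definition tilt :: "('a :: real_vector \<Rightarrow> real) \<Rightarrow> 'a \<Rightarrow> 'a \<Rightarrow> real" where
  "tilt p y x = (INF t\<in>{0..}. p (x + t *\<^sub>R y) - t * p y)"

lemma
  assumes p: "sublinear p"
  shows tilt_le: "t \<ge> 0 \<Longrightarrow> tilt p y x \<le> p (x + t *\<^sub>R y) - t * p y"
    and sublinear_tilt: "sublinear (tilt p y)"
proof -
  have add: "p (x + y) \<le> p x + p y" for x y using p by (simp add: sublinear_def)
  have scale: "t \<ge> 0 \<Longrightarrow> p (t *\<^sub>R x) = t * p x" for t x using p by (simp add: sublinear_def)
  have lower: "- p (- x) \<le> p (x + t *\<^sub>R y) - t * p y" if "t \<ge> 0" for x t
    using add[of "x + t *\<^sub>R y" "- x"] scale[OF that, of y] by (simp add: algebra_simps)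
  have bdd: "bdd_below ((\<lambda>t. p (x + t *\<^sub>R y) - t * p y) ` {0..})" for x
    by (rule bdd_belowI[of _ "- p (- x)"]) (use lower in auto)
  show le: "tilt p y x \<le> p (x + t *\<^sub>R y) - t * p y" if "t \<ge> 0" for t x
    unfolding tilt_def using bdd that by (intro cINF_lower) auto
  have ge: "c \<le> tilt p y x" if "\<And>t. t \<ge> 0 \<Longrightarrow> c \<le> p (x + t *\<^sub>R y) - t * p y" for c x
    unfolding tilt_def using that by (intro cINF_greatest) auto
  have "tilt p y (x + z) \<le> tilt p y x + tilt p y z" for x z
  proof -
    have "tilt p y (x + z) - (p (x + s *\<^sub>R y) - s * p y) \<le> tilt p y z" if "s \<ge> 0" for s
    proof (rule ge)
      fix t :: real assume "t \<ge> 0"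
      then show "tilt p y (x + z) - (p (x + s *\<^sub>R y) - s * p y) \<le> p (z + t *\<^sub>R y) - t * p y"
        using le[of "s + t" "x + z"] add[of "x + s *\<^sub>R y" "z + t *\<^sub>R y"] that
        by (simp add: algebra_simps)
    qed
    then have "tilt p y (x + z) - tilt p y z \<le> tilt p y x"
      by (intro ge) (simp add: algebra_simps)
    then show ?thesis by simp
  qed
  moreover have "tilt p y (c *\<^sub>R x) = c * tilt p y x" if "c \<ge> 0" for c x
  proof (cases "c = 0")
    case True
    have "p 0 = 0" using scale[of 0 0] by simp
    then have "tilt p y 0 = 0"
      using le[of 0 0] ge[of 0 0] scale by (intro antisym) auto
    then show ?thesis using True by simp
  next
    case False
    then have c: "c > 0" using that by simp
    show ?thesis
    proof (rule antisym)
      have "tilt p y (c *\<^sub>R x) / c \<le> tilt p y x"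
      proof (rule ge)
        fix t :: real assume t: "t \<ge> 0"
        have "tilt p y (c *\<^sub>R x) \<le> p (c *\<^sub>R (x + t *\<^sub>R y)) - (c * t) * p y"
          using le[of "c * t" "c *\<^sub>R x"] c t by (simp add: algebra_simps)
        also have "\<dots> = c * (p (x + t *\<^sub>R y) - t * p y)"
          using c scale[of c "x + t *\<^sub>R y"] by (simp add: algebra_simps)
        finally show "tilt p y (c *\<^sub>R x) / c \<le> p (x + t *\<^sub>R y) - t * p y"
          using c by (simp add: field_simps)
      qed
      then show "tilt p y (c *\<^sub>R x) \<le> c * tilt p y x" using c by (simp add: field_simps)
      show "c * tilt p y x \<le> tilt p y (c *\<^sub>R x)"
      proof (rule ge)
        fix t :: real assume t: "t \<ge> 0"
        have "c * tilt p y x \<le> c * (p (x + (t / c) *\<^sub>R y) - t / c * p y)"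
          using le[of "t / c" x] c t by (intro mult_left_mono) auto
        also have "\<dots> = p (c *\<^sub>R (x + (t / c) *\<^sub>R y)) - t * p y"
          using c scale[of c "x + (t / c) *\<^sub>R y"] by (simp add: algebra_simps)
        also have "\<dots> = p (c *\<^sub>R x + t *\<^sub>R y) - t * p y"
          using c by (simp add: algebra_simps)
        finally show "c * tilt p y x \<le> p (c *\<^sub>R x + t *\<^sub>R y) - t * p y" .
      qed
    qed
  qed
  ultimately show "sublinear (tilt p y)" unfolding sublinear_def by blast
qed

text \<open>
  By minimality \<open>p\<close> equals each of its tilts, so that \<open>p x \<le> p (x + y) - p y\<close>; this is the
  missing half of additivity.
\<close>

lemma minimal_sublinear_linear:
  assumes p: "sublinear p" and min: "\<And>q. sublinear q \<Longrightarrow> q \<le> p \<Longrightarrow> q = p"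
  shows "linear p"
proof -
  have add: "p (x + y) = p x + p y" for x y
  proof -
    have "tilt p y \<le> p" using tilt_le[OF p, of 0] by (auto simp: le_fun_def)
    then have "tilt p y = p" by (intro min sublinear_tilt p)
    then have "p x + p y \<le> p (x + y)" using tilt_le[OF p, of 1 y x] by simp
    moreover have "p (x + y) \<le> p x + p y" using p by (simp add: sublinear_def)
    ultimately show ?thesis by simp
  qed
  have pos: "p (t *\<^sub>R x) = t * p x" if "t \<ge> 0" for t x
    using p that by (simp add: sublinear_def)
  have "p 0 = 0" using pos[of 0 0] by simp
  then have neg: "p (- x) = - p x" for x using add[of x "- x"] by simp
  have "p (t *\<^sub>R x) = t * p x" for t x
    using pos[of t x] pos[of "- t" x] neg[of "t *\<^sub>R x"] by (cases "t \<ge> 0") auto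
  then show ?thesis by (intro linearI) (simp_all add: add)
qed

text \<open>
  Zorn's lemma yields a minimal sublinear function below \<open>p\<close>. The pointwise infimum of a nonempty
  chain of sublinear functions below \<open>p\<close> is finite since such functions are at least \<open>- p (- x)\<close>
  at \<open>x\<close>, and it is subadditive because any two members of a chain are comparable. Working with
  sublinear functions on the whole space avoids partially defined functionals.
\<close>

lemma sublinear_dominates_linear:
  assumes p: "sublinear (p :: 'a :: real_vector \<Rightarrow> real)"
  obtains q where "linear q" "q \<le> p"
proof -
  let ?A = "{q. sublinear q \<and> q \<le> p}"
  let ?P = "\<lambda>q r :: 'a \<Rightarrow> real. r \<le> q"
  have "\<exists>m\<in>?A. \<forall>a\<in>?A. ?P m a \<longrightarrow> a = m"
  proof (rule predicate_Zorn)
    show "partial_order_on ?A (relation_of ?P ?A)"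
      by (rule partial_order_on_relation_ofI) auto
    fix C assume C: "C \<in> Chains (relation_of ?P ?A)"
    have CA: "sublinear q" "q \<le> p" if "q \<in> C" for q
      using C that by (auto simp: Chains_def relation_of_def)
    have chain: "q \<le> r \<or> r \<le> q" if "q \<in> C" "r \<in> C" for q r
      using C that by (auto simp: Chains_def relation_of_def)
    show "\<exists>u\<in>?A. \<forall>a\<in>C. ?P a u"
    proof (cases "C = {}")
      case True
      then show ?thesis using p by auto
    next
      case False
      define m where "m x = (INF q\<in>C. q x)" for x
      have lower: "- p (- x) \<le> q x" if "q \<in> C" for q x
        using sublinear_minus_le[OF CA(1)[OF that], of x] CA(2)[OF that]
        by (auto simp: le_fun_def dest!: spec[of _ "- x"])
      have le: "m x \<le> q x" if "q \<in> C" for q x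
        unfolding m_def using that
        by (intro cINF_lower bdd_belowI[of _ "- p (- x)"]) (auto simp: lower)
      have ge: "c \<le> m x" if "\<And>q. q \<in> C \<Longrightarrow> c \<le> q x" for c x
        unfolding m_def using that False by (intro cINF_greatest) auto
      have "m (x + y) \<le> m x + m y" for x y
      proof -
        have *: "m (x + y) \<le> q x + r y" if qr: "q \<in> C" "r \<in> C" for q r
        proof -
          obtain s where s: "s \<in> C" "s \<le> q" "s \<le> r" using chain[OF qr] qr by auto
          have "m (x + y) \<le> s x + s y"
            using le[OF s(1), of "x + y"] CA(1)[OF s(1)] unfolding sublinear_def
            by (meson order_trans)
          then show ?thesis using s(2,3) by (smt (verit) le_fun_def)
        qed
        have "m (x + y) - m y \<le> q x" if "q \<in> C" for q
        proof -
          have "m (x + y) - q x \<le> m y"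
            using *[OF that] by (intro ge) (simp add: diff_le_eq add.commute)
          then show ?thesis by simp
        qed
        then have "m (x + y) - m y \<le> m x" by (rule ge)
        then show ?thesis by simp
      qed
      moreover have "m (t *\<^sub>R x) = t * m x" if t: "t \<ge> 0" for t x
      proof (cases "t = 0")
        case True
        have q0: "q 0 = 0" if "q \<in> C" for q
          using CA(1)[OF that] unfolding sublinear_def by (metis mult_zero_left order_refl scaleR_zero_left)
        moreover obtain q where "q \<in> C" using False by auto
        ultimately have "m 0 = 0"
          using le[of q 0] ge[of 0 0] by (metis antisym order_refl)
        then show ?thesis using True by simp
      next
        case t0: False
        have sc: "q (t *\<^sub>R x) = t * q x" if "q \<in> C" for q x
          using CA(1)[OF that] t by (simp add: sublinear_def)
        show ?thesis
        proof (rule antisym)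
          have "m (t *\<^sub>R x) / t \<le> m x"
            using le[of _ "t *\<^sub>R x"] t t0 by (intro ge) (simp add: sc field_simps)
          then show "m (t *\<^sub>R x) \<le> t * m x" using t t0 by (simp add: field_simps)
          show "t * m x \<le> m (t *\<^sub>R x)"
            using le[of _ x] t by (intro ge) (simp add: sc mult_left_mono)
        qed
      qed
      ultimately have "sublinear m" by (simp add: sublinear_def)
      moreover have "m \<le> p" using False le CA(2) by (fastforce simp: le_fun_def intro: order_trans)
      ultimately show ?thesis using le by (auto simp: le_fun_def)
    qed
  qed
  then obtain m where m: "sublinear m" "m \<le> p" and "\<And>a. sublinear a \<Longrightarrow> a \<le> p \<Longrightarrow> a \<le> m \<Longrightarrow> a = m"
    by auto
  then have "linear m" by (intro minimal_sublinear_linear) (auto intro: order_trans)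
  then show ?thesis using m that by blast
qed

definition contractive_functional :: "('a :: complex_normed_vector \<Rightarrow> complex) \<Rightarrow> bool" where
  "contractive_functional u \<longleftrightarrow> clinear u \<and> (\<forall>x. cmod (u x) \<le> norm x)"

text \<open>
  A linear minorant of the norm tilted along \<open>z\<close> takes at \<open>- z\<close> a value of at most \<open>- norm z\<close>, and
  hence the value \<open>norm z\<close> at \<open>z\<close>. A real functional \<open>q\<close> is the real part of the complex-linear
  functional \<open>q x - \<i> q (\<i> x)\<close>, which inherits the bound after rotating its values onto the positive
  real axis.
\<close>

lemma norming_functional:
  fixes z :: "'a :: complex_normed_vector"
  obtains u where "contractive_functional u" "u z = of_real (norm z)"
proof -
  have n: "sublinear (norm :: 'a \<Rightarrow> real)"
    by (auto simp: sublinear_def norm_triangle_ineq)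
  obtain q where q: "linear q" "q \<le> tilt norm z"
    using sublinear_dominates_linear[OF sublinear_tilt[OF n]] by blast
  note add = linear_add[OF q(1)] and scale = linear_scale[OF q(1)]
  have le: "q x \<le> norm x" for x
    using tilt_le[OF n, of 0 z x] q(2) by (simp add: le_fun_def) (meson order_trans)
  \<comment> \<open>The tilt at \<open>t = 1\<close>, where \<open>- z + z\<close> vanishes.\<close>
  have "q (- z) \<le> - norm z"
    using tilt_le[OF n, of 1 z "- z"] q(2) by (simp add: le_fun_def) (meson order_trans)
  then have qz: "q z = norm z"
    using le[of z] linear_neg[OF q(1), of z] by simp
  define u where "u x = Complex (q x) (- q (\<i> *\<^sub>C x))" for x
  have sp: "c *\<^sub>C x = Re c *\<^sub>R x + Im c *\<^sub>R (\<i> *\<^sub>C x)" for c and x :: 'a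
    by (subst complex_eq) (simp add: scaleC_add_left scaleC_scaleC mult.commute flip: scaleC_of_real)
  have isq: "\<i> *\<^sub>C \<i> *\<^sub>C x = - x" for x :: 'a
    using scaleC_of_real[of "- 1" x] by (simp add: scaleC_scaleC)
  have lin: "clinear u"
    unfolding clinear_iff
  proof (intro conjI allI)
    show "u (x + y) = u x + u y" for x y
      by (simp add: u_def scaleC_add_right add complex_eq_iff)
    show "u (c *\<^sub>C x) = c *\<^sub>C u x" for c x
    proof -
      have 1: "q (c *\<^sub>C x) = Re c * q x + Im c * q (\<i> *\<^sub>C x)"
        by (subst sp) (simp add: add scale)
      have "(\<i> * c) *\<^sub>C x = c *\<^sub>C \<i> *\<^sub>C x" by (simp add: scaleC_scaleC mult.commute)
      also have "\<dots> = Re c *\<^sub>R (\<i> *\<^sub>C x) + Im c *\<^sub>R (- x)"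
        using sp[of c "\<i> *\<^sub>C x"] by (simp only: isq)
      finally have 2: "q ((\<i> * c) *\<^sub>C x) = Re c * q (\<i> *\<^sub>C x) - Im c * q x"
        by (simp add: add scale linear_diff[OF q(1)])
      show ?thesis by (simp add: u_def complex_eq_iff scaleC_complex_def 1 2 algebra_simps)
    qed
  qed
  have bound: "cmod (u x) \<le> norm x" for x
  proof (cases "u x = 0")
    case False
    define c where "c = cnj (u x) / of_real (cmod (u x))"
    have c: "cmod c = 1" using False by (simp add: c_def norm_divide)
    have "c * u x = of_real (cmod (u x))"
      using False by (simp add: c_def complex_norm_square[symmetric] power2_eq_square mult.commute)
    then have "u (c *\<^sub>C x) = of_real (cmod (u x))"
      using lin by (simp add: clinear_iff scaleC_complex_def)
    then have "q (c *\<^sub>C x) = cmod (u x)" by (metis Re_complex_of_real complex.sel(1) u_def)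
    then show ?thesis using le[of "c *\<^sub>C x"] c by (simp add: norm_scaleC)
  qed simp
  have "Re (u z) = norm z" by (simp add: u_def qz)
  moreover have "Im (u z) = 0"
  proof -
    have "(Re (u z))\<^sup>2 + (Im (u z))\<^sup>2 \<le> (norm z)\<^sup>2"
      using power_mono[OF bound[of z] norm_ge_zero, of 2] by (simp add: cmod_power2)
    then show ?thesis using \<open>Re (u z) = norm z\<close> by simp
  qed
  ultimately have "u z = of_real (norm z)" by (simp add: complex_eq_iff)
  with lin bound that show ?thesis by (auto simp: contractive_functional_def)
qed

section \<open>Holomorphic Lipschitz functions\<close>

definition holo_lip :: "real \<Rightarrow> ('a :: complex_normed_vector \<Rightarrow> complex) \<Rightarrow> bool" where
  "holo_lip C f \<longleftrightarrow> f frechet_holomorphic_on ball 0 1 \<and> C-lipschitz_on (ball 0 1) f"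

lemma holo_lip_nonneg: "holo_lip C f \<Longrightarrow> 0 \<le> C"
  by (auto simp: holo_lip_def dest: lipschitz_on_nonneg)

lemma holo_lip_dist:
  "holo_lip C f \<Longrightarrow> x \<in> ball 0 1 \<Longrightarrow> y \<in> ball 0 1 \<Longrightarrow> cmod (f x - f y) \<le> C * norm (x - y)"
  unfolding holo_lip_def by (auto dest: lipschitz_on_normD)

lemma holo_lip_bound: "holo_lip C f \<Longrightarrow> x \<in> ball 0 1 \<Longrightarrow> cmod (f x) \<le> cmod (f 0) + C"
proof -
  assume f: "holo_lip C f" and x: "x \<in> ball 0 1"
  have "cmod (f x - f 0) \<le> C * norm x" using holo_lip_dist[OF f x, of 0] by simp
  also have "\<dots> \<le> C" using x holo_lip_nonneg[OF f] by (simp add: mult_left_le)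
  finally show ?thesis using norm_triangle_sub[of "f x" "f 0"] by simp
qed

lemma holo_lip_const: "holo_lip 0 (\<lambda>x. c)"
  unfolding holo_lip_def frechet_holomorphic_on_def
  by (auto intro!: exI[of _ "\<lambda>x. 0"] lipschitz_on_constant simp: clinear_iff scaleC_complex_def)

lemma holo_lip_add:
  "holo_lip C f \<Longrightarrow> holo_lip D g \<Longrightarrow> holo_lip (C + D) (\<lambda>x. f x + g x)"
  unfolding holo_lip_def frechet_holomorphic_on_def
  by (blast intro: has_derivative_add clinear_compose_add lipschitz_on_add)

lemma holo_lip_mult:
  assumes f: "holo_lip C f" and g: "holo_lip D g"
    and F: "\<And>x. x \<in> ball 0 1 \<Longrightarrow> cmod (f x) \<le> F" and G: "\<And>x. x \<in> ball 0 1 \<Longrightarrow> cmod (g x) \<le> G"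
  shows "holo_lip (F * D + C * G) (\<lambda>x. f x * g x)"
proof -
  have "(\<lambda>x. f x * g x) frechet_holomorphic_on ball 0 1"
    unfolding frechet_holomorphic_on_def
  proof
    fix x :: 'a assume x: "x \<in> ball 0 1"
    obtain f' g' where "(f has_derivative f') (at x)" "clinear f'"
      "(g has_derivative g') (at x)" "clinear g'"
      using f g x unfolding holo_lip_def frechet_holomorphic_on_def by blast
    then have "((\<lambda>x. f x * g x) has_derivative (\<lambda>h. f x * g' h + f' h * g x)) (at x)"
      and "clinear (\<lambda>h. f x * g' h + f' h * g x)"
      by (auto intro: has_derivative_mult simp: clinear_iff scaleC_complex_def algebra_simps)
    then show "\<exists>f'. ((\<lambda>x. f x * g x) has_derivative f') (at x) \<and> clinear f'" by blast
  qed
  moreover have "(F * D + C * G)-lipschitz_on (ball 0 1) (\<lambda>x. f x * g x)"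
  proof (rule lipschitz_onI)
    have F0: "0 \<le> F" using order_trans[OF norm_ge_zero F[of 0]] by simp
    have G0: "0 \<le> G" using order_trans[OF norm_ge_zero G[of 0]] by simp
    show "0 \<le> F * D + C * G" using F0 G0 holo_lip_nonneg[OF f] holo_lip_nonneg[OF g] by simp
    fix x y :: 'a assume x: "x \<in> ball 0 1" and y: "y \<in> ball 0 1"
    have "cmod (f x * g x - f y * g y) = cmod (f x * (g x - g y) + (f x - f y) * g y)"
      by (simp add: algebra_simps)
    also have "\<dots> \<le> cmod (f x) * cmod (g x - g y) + cmod (f x - f y) * cmod (g y)"
      using norm_triangle_ineq by (metis norm_mult)
    also have "\<dots> \<le> F * (D * norm (x - y)) + (C * norm (x - y)) * G"
      using F[OF x] G[OF y] holo_lip_dist[OF f x y] holo_lip_dist[OF g x y] F0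
        holo_lip_nonneg[OF f]
      by (intro add_mono mult_mono) auto
    finally show "dist (f x * g x) (f y * g y) \<le> (F * D + C * G) * dist x y"
      by (simp add: dist_norm algebra_simps)
  qed
  ultimately show ?thesis by (simp add: holo_lip_def)
qed

text \<open>
  The inner map may be stretching by more than 1; only its values need to stay in the ball. This
  covers both the dilations and the cylinder functions below.
\<close>

lemma holo_lip_affine:
  fixes A :: "'a :: complex_normed_vector \<Rightarrow> 'b :: complex_normed_vector"
  assumes f: "holo_lip C f" and A: "clinear A" "\<And>x. norm (A x) \<le> K * norm x" and K: "0 \<le> K"
    and ball: "\<And>x. x \<in> ball 0 1 \<Longrightarrow> y + A x \<in> ball 0 1"
  shows "holo_lip (C * K) (\<lambda>x. f (y + A x))"
proof -
  have add: "A (u + v) = A u + A v" and scale: "A (c *\<^sub>C u) = c *\<^sub>C A u" for u v c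
    using A(1) by (simp_all add: clinear_iff)
  have "bounded_linear A"
  proof (rule bounded_linear_intro[where K = K])
    show "A (r *\<^sub>R x) = r *\<^sub>R A x" for r x
      using scale[of "of_real r" x] by (simp only: scaleC_of_real)
  qed (use A add in \<open>auto simp: mult.commute\<close>)
  then have dA: "((\<lambda>x. y + A x) has_derivative A) (at x)" for x
    using has_derivative_add[OF has_derivative_const bounded_linear_imp_has_derivative]
    by fastforce
  have "(\<lambda>x. f (y + A x)) frechet_holomorphic_on ball 0 1"
    unfolding frechet_holomorphic_on_def
  proof
    fix x :: 'a assume x: "x \<in> ball 0 1"
    obtain f' where f': "(f has_derivative f') (at (y + A x))" "clinear f'"
      using f ball[OF x] unfolding holo_lip_def frechet_holomorphic_on_def by blast
    have "((\<lambda>x. f (y + A x)) has_derivative (\<lambda>h. f' (A h))) (at x)"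
      using has_derivative_compose[OF dA f'(1)] .
    moreover have "clinear (\<lambda>h. f' (A h))"
      using f'(2) add scale by (simp add: clinear_iff)
    ultimately show "\<exists>f'. ((\<lambda>x. f (y + A x)) has_derivative f') (at x) \<and> clinear f'" by blast
  qed
  moreover have "(C * K)-lipschitz_on (ball 0 1) (\<lambda>x. f (y + A x))"
  proof (rule lipschitz_onI)
    fix u v :: 'a assume u: "u \<in> ball 0 1" and v: "v \<in> ball 0 1"
    have "cmod (f (y + A u) - f (y + A v)) \<le> C * norm (A u - A v)"
      using holo_lip_dist[OF f ball[OF u] ball[OF v]] by simp
    also have "A u - A v = A (u - v)" using add[of "u - v" v] by simp
    also have "C * norm (A (u - v)) \<le> C * (K * norm (u - v))"
      using A(2) holo_lip_nonneg[OF f] by (intro mult_left_mono) auto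
    finally show "dist (f (y + A u)) (f (y + A v)) \<le> C * K * dist u v"
      by (simp add: dist_norm mult.assoc)
  qed (use holo_lip_nonneg[OF f] K in simp)
  ultimately show ?thesis by (simp add: holo_lip_def)
qed

lemma holo_lip_contractive:
  assumes "contractive_functional u"
  shows "holo_lip 1 u"
proof -
  have u: "clinear u" "\<And>x. cmod (u x) \<le> norm x"
    using assms by (auto simp: contractive_functional_def)
  have add: "u (x + y) = u x + u y" and scale: "u (c *\<^sub>C x) = c *\<^sub>C u x" for x y c
    using u(1) by (simp_all add: clinear_iff)
  have "bounded_linear u"
  proof (rule bounded_linear_intro[where K = 1])
    show "u (r *\<^sub>R x) = r *\<^sub>R u x" for r x
      using scale[of "of_real r" x] by (simp only: scaleC_of_real)
  qed (use u add in auto)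
  then have "u frechet_holomorphic_on ball 0 1"
    unfolding frechet_holomorphic_on_def using u(1) bounded_linear_imp_has_derivative by blast
  moreover have "1-lipschitz_on (ball 0 1) u"
  proof (rule lipschitz_onI)
    show "dist (u x) (u y) \<le> 1 * dist x y" for x y
      using u(2)[of "x - y"] add[of "x - y" y] by (simp add: dist_norm algebra_simps)
  qed simp
  ultimately show ?thesis by (simp add: holo_lip_def)
qed

text \<open>
  The lower bound 1 keeps the Lipschitz constant unchanged, because \<open>1/a - 1/b = (b - a)/(ab)\<close>.
\<close>

lemma holo_lip_inverse:
  assumes f: "holo_lip C f" and ge: "\<And>x. x \<in> ball 0 1 \<Longrightarrow> 1 \<le> cmod (f x)"
  shows "holo_lip C (\<lambda>x. inverse (f x))"
proof -
  have nz: "f x \<noteq> 0" if "x \<in> ball 0 1" for x using ge[OF that] by auto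
  have "(\<lambda>x. inverse (f x)) frechet_holomorphic_on ball 0 1"
    unfolding frechet_holomorphic_on_def
  proof
    fix x :: 'a assume x: "x \<in> ball 0 1"
    obtain f' where f': "(f has_derivative f') (at x)" "clinear f'"
      using f x unfolding holo_lip_def frechet_holomorphic_on_def by blast
    have "((\<lambda>x. inverse (f x)) has_derivative (\<lambda>h. - (inverse (f x) * f' h * inverse (f x)))) (at x)"
      using Deriv.has_derivative_inverse[OF nz[OF x] f'(1)] .
    moreover have "clinear (\<lambda>h. - (inverse (f x) * f' h * inverse (f x)))"
      using f'(2) by (simp add: clinear_iff scaleC_complex_def algebra_simps)
    ultimately show "\<exists>f'. ((\<lambda>x. inverse (f x)) has_derivative f') (at x) \<and> clinear f'" by blast
  qed
  moreover have "C-lipschitz_on (ball 0 1) (\<lambda>x. inverse (f x))"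
  proof (rule lipschitz_onI)
    fix x y :: 'a assume x: "x \<in> ball 0 1" and y: "y \<in> ball 0 1"
    have "inverse (f x) - inverse (f y) = (f y - f x) / (f x * f y)"
      using nz[OF x] nz[OF y] by (simp add: field_simps)
    then have "cmod (inverse (f x) - inverse (f y)) = cmod (f y - f x) / (cmod (f x) * cmod (f y))"
      by (simp add: norm_divide norm_mult)
    also have "\<dots> \<le> cmod (f y - f x) / 1"
      using mult_mono[OF ge[OF x] ge[OF y]] by (intro divide_left_mono) auto
    also have "\<dots> \<le> C * norm (x - y)"
      using holo_lip_dist[OF f y x] by (simp add: norm_minus_commute)
    finally show "dist (inverse (f x)) (inverse (f y)) \<le> C * dist x y"
      by (simp add: dist_norm)
  qed (rule holo_lip_nonneg[OF f])
  ultimately show ?thesis by (simp add: holo_lip_def)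
qed

lemma holo_lip_holomorphic_on_line:
  assumes f: "holo_lip C f" and S: "\<And>z. z \<in> S \<Longrightarrow> y + z *\<^sub>C b \<in> ball 0 1"
  shows "(\<lambda>z. f (y + z *\<^sub>C b)) holomorphic_on S"
  unfolding holomorphic_on_def
proof
  fix z assume z: "z \<in> S"
  obtain f' where f': "(f has_derivative f') (at (y + z *\<^sub>C b))" "clinear f'"
    using f S[OF z] unfolding holo_lip_def frechet_holomorphic_on_def by blast
  have "bounded_linear (\<lambda>z. z *\<^sub>C b)"
  proof (rule bounded_linear_intro[where K = "norm b"])
    show "(r *\<^sub>R x) *\<^sub>C b = r *\<^sub>R (x *\<^sub>C b)" for r x
      by (simp only: scaleR_conv_of_real scaleC_scaleC flip: scaleC_of_real)
  qed (simp_all add: scaleC_add_left norm_scaleC)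
  then have "((\<lambda>z. y + z *\<^sub>C b) has_derivative (\<lambda>z. z *\<^sub>C b)) (at z)"
    using has_derivative_add[OF has_derivative_const bounded_linear_imp_has_derivative]
    by fastforce
  from has_derivative_compose[OF this f'(1)]
  have "((\<lambda>z. f (y + z *\<^sub>C b)) has_derivative (\<lambda>z. f' (z *\<^sub>C b))) (at z)" .
  moreover have "(\<lambda>z. f' (z *\<^sub>C b)) = (*) (f' b)"
    using f'(2) by (auto simp: clinear_iff scaleC_complex_def mult.commute)
  ultimately have "((\<lambda>z. f (y + z *\<^sub>C b)) has_field_derivative f' b) (at z)"
    by (simp add: has_field_derivative_def)
  then show "(\<lambda>z. f (y + z *\<^sub>C b)) field_differentiable at z within S"
    using field_differentiable_at_within field_differentiable_def by blast
qed

section \<open>The unital extension of a functional\<close>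

text \<open>
  The constant \<open>f 0\<close> is subtracted in order to land in the space of functions vanishing at the
  origin; the values off the ball follow the convention for representatives.
\<close>

definition HL0_of :: "('a :: complex_normed_vector \<Rightarrow> complex) \<Rightarrow> 'a HL0" where
  "HL0_of f = Abs_HL0 (\<lambda>x. if x \<in> ball 0 1 then f x - f 0 else 0)"

lemma
  assumes f: "holo_lip C f"
  shows HL0_apply_HL0_of: "HL0_apply (HL0_of f) = (\<lambda>x. if x \<in> ball 0 1 then f x - f 0 else 0)"
    and norm_HL0_of_le: "norm (HL0_of f) \<le> C"
proof -
  let ?g = "\<lambda>x. if x \<in> ball 0 1 then f x - f 0 else 0"
  have lip: "C-lipschitz_on (ball 0 1) ?g"
    using f by (auto simp: holo_lip_def lipschitz_on_def dist_norm)
  have "?g frechet_holomorphic_on ball 0 1"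
    unfolding frechet_holomorphic_on_def
  proof
    fix x :: 'a assume x: "x \<in> ball 0 1"
    obtain f' where f': "(f has_derivative f') (at x)" "clinear f'"
      using f x unfolding holo_lip_def frechet_holomorphic_on_def by blast
    have "((\<lambda>x. f x - f 0) has_derivative f') (at x)"
      using has_derivative_diff[OF f'(1) has_derivative_const[of "f 0"]] by simp
    then have "(?g has_derivative f') (at x)"
      by (rule has_derivative_transform_within_open[where s = "ball 0 1"]) (use x in auto)
    then show "\<exists>f'. (?g has_derivative f') (at x) \<and> clinear f'" using f'(2) by blast
  qed
  then have "?g \<in> HL0_carrier" using lip by (auto simp: HL0_carrier_def)
  then show eq: "HL0_apply (HL0_of f) = ?g"
    by (simp add: HL0_of_def Abs_HL0_inverse)
  show "norm (HL0_of f) \<le> C"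
    unfolding norm_HL0.rep_eq eq by (rule lipschitz_constant_le) (rule lip)
qed

lemma HL0_apply_zero: "HL0_apply g 0 = 0"
  using HL0_apply[of g] by (simp add: HL0_carrier_def)

lemma HL0_apply_outside: "x \<notin> ball 0 1 \<Longrightarrow> HL0_apply g x = 0"
  using HL0_apply[of g] by (simp add: HL0_carrier_def)

lemma holo_lip_HL0_apply: "holo_lip (norm g) (HL0_apply g)"
  using HL0_apply[of g] HL0_lipschitz[of g]
  by (simp add: holo_lip_def HL0_carrier_def norm_HL0.rep_eq)

lemma HL0_eqI:
  assumes "\<And>x. x \<in> ball 0 1 \<Longrightarrow> HL0_apply g x = HL0_apply h x"
  shows "g = h"
  using assms HL0_apply_outside by (metis HL0_apply_inject ext)

lemma HL0_of_add:
  "holo_lip C f \<Longrightarrow> holo_lip D g \<Longrightarrow> HL0_of (\<lambda>x. f x + g x) = HL0_of f + HL0_of g"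
  by (rule HL0_eqI)
    (simp add: HL0_apply_HL0_of[OF holo_lip_add] HL0_apply_HL0_of plus_HL0.rep_eq)

lemma HL0_of_const: "HL0_of (\<lambda>x. c) = 0"
  by (rule HL0_eqI) (simp add: HL0_apply_HL0_of[OF holo_lip_const] zero_HL0.rep_eq)

lemma HL0_of_mult:
  assumes f: "holo_lip C f" and g: "holo_lip D g"
  shows "HL0_of (\<lambda>x. f x * g x) = HL0_of f * HL0_of g + f 0 *\<^sub>C HL0_of g + g 0 *\<^sub>C HL0_of f"
proof -
  have "holo_lip ((cmod (f 0) + C) * D + C * (cmod (g 0) + D)) (\<lambda>x. f x * g x)"
    by (rule holo_lip_mult[OF f g]) (use holo_lip_bound[OF f] holo_lip_bound[OF g] in auto)
  then show ?thesis
    by (intro HL0_eqI)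
      (simp add: HL0_apply_HL0_of HL0_apply_HL0_of[OF f] HL0_apply_HL0_of[OF g]
        plus_HL0.rep_eq times_HL0.rep_eq scaleC_HL0.rep_eq scaleC_complex_def algebra_simps)
qed

lemma HL0_of_cong: 
  assumes "\<And>x. x \<in> ball 0 1 \<Longrightarrow> f x = g x"
  shows "HL0_of f = HL0_of g"
proof -
  have "(\<lambda>x. if x \<in> ball 0 1 then f x - f 0 else 0) = (\<lambda>x. if x \<in> ball 0 1 then g x - g 0 else 0)"
    using assms by auto
  then show ?thesis by (simp add: HL0_of_def)
qed

text \<open>
  Functions on the ball split as a constant plus a function vanishing at the origin. This is the
  extension of \<open>\<phi>\<close> by the value 1 on the constant function 1, which makes resolvents such as
  \<open>1/(z - u)\<close> available.
\<close>

definition unital_extension ::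
    "('a :: complex_normed_vector HL0 \<Rightarrow>\<^sub>L complex) \<Rightarrow> ('a \<Rightarrow> complex) \<Rightarrow> complex" where
  "unital_extension \<phi> f = f 0 + \<phi> (HL0_of f)"

lemma unital_extension_const: "unital_extension \<phi> (\<lambda>x. c) = c"
  by (simp add: unital_extension_def HL0_of_const blinfun.zero_right)

lemma G0_scale: "\<phi> \<in> G0 \<Longrightarrow> blinfun_apply \<phi> (c *\<^sub>C g) = c * \<phi> g"
  using G0_subset_HL0_dual by (auto simp: HL0_dual_def clinear_iff scaleC_complex_def)

lemma unital_extension_add:
  "holo_lip C f \<Longrightarrow> holo_lip D g \<Longrightarrow>
    unital_extension \<phi> (\<lambda>x. f x + g x) = unital_extension \<phi> f + unital_extension \<phi> g"
  by (simp add: unital_extension_def HL0_of_add blinfun.add_right)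

text \<open>
  With \<open>f = a + f\<^sub>1\<close> and \<open>g = b + g\<^sub>1\<close> for the values \<open>a\<close>, \<open>b\<close> at the origin, the product is
  \<open>ab + (f\<^sub>1 g\<^sub>1 + a g\<^sub>1 + b f\<^sub>1)\<close>. Elements of \<^const>\<open>G0\<close> are complex linear, so multiplicativity of
  \<open>\<phi>\<close> suffices.
\<close>

lemma unital_extension_mult:
  assumes "\<phi> \<in> G0" "multiplicative \<phi>" and f: "holo_lip C f" and g: "holo_lip D g"
  shows "unital_extension \<phi> (\<lambda>x. f x * g x) = unital_extension \<phi> f * unital_extension \<phi> g"
  using assms(2)
  by (simp add: unital_extension_def HL0_of_mult[OF f g] blinfun.add_right G0_scale[OF assms(1)]
      multiplicative_def algebra_simps)

lemma unital_extension_cong: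
  "(\<And>x. x \<in> ball 0 1 \<Longrightarrow> f x = g x) \<Longrightarrow> unital_extension \<phi> f = unital_extension \<phi> g"
  using HL0_of_cong[of f g] by (simp add: unital_extension_def)

lemma delta_HL0_of:
  "holo_lip C f \<Longrightarrow> x \<in> ball 0 1 \<Longrightarrow> delta x (HL0_of f) = f x - f 0"
  using ball_subset_cball by (subst delta_apply) (auto simp: HL0_ext_def HL0_apply_HL0_of)

section \<open>Limits of combinations of evaluations\<close>

lemma G0_approx:
  assumes "\<phi> \<in> G0"
  obtains \<psi> where "\<And>n :: nat. \<psi> n \<in> cspan (delta ` ball 0 1)" "\<psi> \<longlonglongrightarrow> \<phi>"
  using assms by (auto simp: G0_def closure_sequential)

text \<open>
  Norm convergence of functionals is uniform on norm-bounded families. Applied to a parametrised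
  family, it transfers holomorphy in the parameter and contour integrals over it from combinations
  of evaluations to all of \<^const>\<open>G0\<close>.
\<close>

lemma uniform_limit_blinfun_apply:
  assumes \<psi>: "(\<psi> \<longlongrightarrow> \<phi>) F" and h: "\<And>z. z \<in> S \<Longrightarrow> norm (h z) \<le> C"
  shows "uniform_limit S (\<lambda>n z. blinfun_apply (\<psi> n) (h z)) (\<lambda>z. blinfun_apply \<phi> (h z)) F"
proof (rule uniform_limitI)
  fix e :: real assume e: "e > 0"
  define D where "D = \<bar>C\<bar> + 1"
  have D: "D > 0" by (simp add: D_def)
  have "\<forall>\<^sub>F n in F. dist (\<psi> n) \<phi> < e / D" using \<psi> e D by (intro tendstoD) auto
  then show "\<forall>\<^sub>F n in F. \<forall>z\<in>S. dist (blinfun_apply (\<psi> n) (h z)) (blinfun_apply \<phi> (h z)) < e"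
  proof eventually_elim
    case (elim n)
    show ?case
    proof
      fix z assume z: "z \<in> S"
      have "norm (blinfun_apply (\<psi> n) (h z) - blinfun_apply \<phi> (h z)) \<le> norm (\<psi> n - \<phi>) * norm (h z)"
        using norm_blinfun[of "\<psi> n - \<phi>" "h z"] by (simp add: blinfun.diff_left)
      also have "\<dots> \<le> norm (\<psi> n - \<phi>) * D"
        using h[OF z] by (intro mult_left_mono) (auto simp: D_def)
      also have "\<dots> < e / D * D" using elim D by (intro mult_strict_right_mono) (auto simp: dist_norm)
      finally show "dist (blinfun_apply (\<psi> n) (h z)) (blinfun_apply \<phi> (h z)) < e"
        using D by (simp add: dist_norm)
    qed
  qed
qed

text \<open>
  The induction principle by which every property of evaluations that is stable under linear
  combinations passes to the span; closures are then treated by a uniform limit.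
\<close>

lemma cspan_delta_induct [consumes 1, case_names zero step]:
  assumes "\<psi> \<in> cspan (delta ` ball 0 1)" and "P 0"
    and "\<And>c x \<psi>. x \<in> ball 0 1 \<Longrightarrow> P \<psi> \<Longrightarrow> P (c *\<^sub>C delta x + \<psi>)"
  shows "P \<psi>"
  using assms by (auto intro: complex_vector.span_induct_alt[of \<psi> "delta ` ball 0 1" P])

lemma combination_apply:
  fixes \<psi> :: "'a :: complex_normed_vector HL0 \<Rightarrow>\<^sub>L complex"
  assumes "holo_lip C h" "x \<in> ball 0 1"
  shows "(c *\<^sub>C delta x + \<psi>) (HL0_of h) = c * (h x - h 0) + \<psi> (HL0_of h)"
  using delta_HL0_of[OF assms]
  by (simp add: plus_blinfun.rep_eq scaleC_blinfun.rep_eq scaleC_complex_def)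

text \<open>
  Holomorphy in the parameter is assumed for each point of the ball separately; it passes to
  combinations of evaluations, and from there to \<open>\<phi>\<close> because the Lipschitz constants are bounded
  uniformly in the parameter.
\<close>

lemma unital_extension_holomorphic:
  fixes \<phi> :: "'a :: complex_normed_vector HL0 \<Rightarrow>\<^sub>L complex"
  assumes \<phi>: "\<phi> \<in> G0" and S: "open S" and h: "\<And>z. z \<in> S \<Longrightarrow> holo_lip C (h z)"
    and hol: "\<And>x. x \<in> ball 0 1 \<Longrightarrow> (\<lambda>z. h z x) holomorphic_on S"
  shows "(\<lambda>z. unital_extension \<phi> (h z)) holomorphic_on S"
proof -
  have span: "(\<lambda>z. \<psi> (HL0_of (h z))) holomorphic_on S" if "\<psi> \<in> cspan (delta ` ball 0 1)"
    for \<psi> :: "'a HL0 \<Rightarrow>\<^sub>L complex"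
    using that
  proof (induction rule: cspan_delta_induct)
    case (step c x \<psi>)
    have "(\<lambda>z. c * (h z x - h z 0) + \<psi> (HL0_of (h z))) holomorphic_on S"
      using hol[of x] hol[of 0] step by (intro holomorphic_intros) auto
    then show ?case
      by (rule holomorphic_transform) (simp add: combination_apply[OF h step(1)])
  qed simp
  obtain \<psi> where \<psi>: "\<And>n :: nat. \<psi> n \<in> cspan (delta ` ball 0 1)" "\<psi> \<longlonglongrightarrow> \<phi>"
    using G0_approx[OF \<phi>] by blast
  have "(\<lambda>z. \<phi> (HL0_of (h z))) holomorphic_on S"
  proof (rule holomorphic_uniform_sequence[OF S])
    show "(\<lambda>z. \<psi> n (HL0_of (h z))) holomorphic_on S" for n
      using span \<psi>(1) by blast
    fix z assume "z \<in> S"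
    then obtain d where d: "0 < d" "cball z d \<subseteq> S" using S open_contains_cball by blast
    moreover have "uniform_limit (cball z d) (\<lambda>n z. \<psi> n (HL0_of (h z))) (\<lambda>z. \<phi> (HL0_of (h z))) sequentially"
      using d(2) norm_HL0_of_le[OF h] by (intro uniform_limit_blinfun_apply[OF \<psi>(2)]) blast
    ultimately show "\<exists>d>0. cball z d \<subseteq> S \<and>
        uniform_limit (cball z d) (\<lambda>n z. \<psi> n (HL0_of (h z))) (\<lambda>z. \<phi> (HL0_of (h z))) sequentially"
      by blast
  qed
  then show ?thesis
    unfolding unital_extension_def using hol[of 0] by (intro holomorphic_intros) auto
qed

text \<open>
  A Fubini theorem for the pairing of functionals with contour integrals. For an evaluation it is
  the hypothesis itself.
\<close>

lemma unital_extension_contour_integral: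
  fixes \<phi> :: "'a :: complex_normed_vector HL0 \<Rightarrow>\<^sub>L complex"
  assumes \<phi>: "\<phi> \<in> G0" and r: "0 < r" and h: "\<And>z. z \<in> sphere c r \<Longrightarrow> holo_lip C (h z)"
    and g: "holo_lip D g"
    and int: "\<And>x. x \<in> ball 0 1 \<Longrightarrow> ((\<lambda>z. h z x) has_contour_integral g x) (circlepath c r)"
  shows "((\<lambda>z. unital_extension \<phi> (h z)) has_contour_integral unital_extension \<phi> g) (circlepath c r)"
proof -
  let ?\<gamma> = "circlepath c r"
  have span: "((\<lambda>z. \<psi> (HL0_of (h z))) has_contour_integral \<psi> (HL0_of g)) ?\<gamma>"
    if "\<psi> \<in> cspan (delta ` ball 0 1)" for \<psi> :: "'a HL0 \<Rightarrow>\<^sub>L complex"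
    using that
  proof (induction rule: cspan_delta_induct)
    case zero
    then show ?case by (simp add: has_contour_integral_0)
  next
    case (step a x \<psi>)
    have "((\<lambda>z. a * (h z x - h z 0) + \<psi> (HL0_of (h z))) has_contour_integral
        a * (g x - g 0) + \<psi> (HL0_of g)) ?\<gamma>"
      using int[of x] int[of 0] step
      by (intro has_contour_integral_add has_contour_integral_lmul has_contour_integral_diff) auto
    then show ?case
      unfolding combination_apply[OF g step(1)]
      by (rule has_contour_integral_eq)
        (use r in \<open>simp add: combination_apply[OF h step(1)]\<close>)
  qed
  obtain \<psi> where \<psi>: "\<And>n :: nat. \<psi> n \<in> cspan (delta ` ball 0 1)" "\<psi> \<longlonglongrightarrow> \<phi>"
    using G0_approx[OF \<phi>] by blast
  have ul: "uniform_limit (sphere c r) (\<lambda>n z. \<psi> n (HL0_of (h z))) (\<lambda>z. \<phi> (HL0_of (h z))) sequentially"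
    using norm_HL0_of_le[OF h] by (intro uniform_limit_blinfun_apply[OF \<psi>(2)])
  have ev: "\<forall>\<^sub>F n in sequentially. (\<lambda>z. \<psi> n (HL0_of (h z))) contour_integrable_on ?\<gamma>"
    using span[OF \<psi>(1)] by (intro always_eventually) (auto simp: contour_integrable_on_def)
  note lim = contour_integral_uniform_limit_circlepath[OF ev ul sequentially_bot r]
  have "(\<lambda>n. contour_integral ?\<gamma> (\<lambda>z. \<psi> n (HL0_of (h z)))) \<longlonglongrightarrow> \<phi> (HL0_of g)"
    unfolding contour_integral_unique[OF span[OF \<psi>(1)]]
    by (intro blinfun.tendsto \<psi>(2) tendsto_const)
  then have "contour_integral ?\<gamma> (\<lambda>z. \<phi> (HL0_of (h z))) = \<phi> (HL0_of g)"
    using lim(2) LIMSEQ_unique by blast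
  then have "((\<lambda>z. \<phi> (HL0_of (h z))) has_contour_integral \<phi> (HL0_of g)) ?\<gamma>"
    using lim(1) has_contour_integral_integral by fastforce
  then show ?thesis
    unfolding unital_extension_def using int[of 0] by (intro has_contour_integral_add) auto
qed

text \<open>
  On norm-bounded sets the elements of \<^const>\<open>G0\<close> are continuous for pointwise convergence on the
  ball: up to a small norm error such an element is a combination of evaluations at a finite set
  \<open>K\<close>. Hence the value at \<open>g\<close> can be computed from norm-bounded approximations of \<open>g\<close> on finite
  sets.
\<close>

lemma G0_eqI:
  fixes \<phi> :: "'a :: complex_normed_vector HL0 \<Rightarrow>\<^sub>L complex"
  assumes \<phi>: "\<phi> \<in> G0"
    and approx: "\<And>K \<epsilon>. finite K \<Longrightarrow> K \<subseteq> ball 0 1 \<Longrightarrow> 0 < \<epsilon> \<Longrightarrow>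
      \<exists>h. norm h \<le> C \<and> (\<forall>x\<in>K. cmod (HL0_apply h x - HL0_apply g x) \<le> \<epsilon>) \<and> cmod (\<phi> h - v) \<le> \<epsilon>"
  shows "\<phi> g = v"
proof -
  have span: "\<exists>K M. finite K \<and> K \<subseteq> ball 0 1 \<and> 0 \<le> M \<and>
      (\<forall>f \<epsilon>. (\<forall>x\<in>K. cmod (HL0_apply f x) \<le> \<epsilon>) \<longrightarrow> 0 \<le> \<epsilon> \<longrightarrow> cmod (\<psi> f) \<le> M * \<epsilon>)"
    if "\<psi> \<in> cspan (delta ` ball 0 1)" for \<psi> :: "'a HL0 \<Rightarrow>\<^sub>L complex"
    using that
  proof (induction rule: cspan_delta_induct)
    case zero
    show ?case by (rule exI[of _ "{}"], rule exI[of _ 0]) simp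
  next
    case (step c x \<psi>)
    then obtain K M where K: "finite K" "K \<subseteq> ball 0 1" "0 \<le> M"
      and M: "\<And>f \<epsilon>. (\<forall>x\<in>K. cmod (HL0_apply f x) \<le> \<epsilon>) \<Longrightarrow> 0 \<le> \<epsilon> \<Longrightarrow> cmod (\<psi> f) \<le> M * \<epsilon>" by blast
    have "cmod ((c *\<^sub>C delta x + \<psi>) f) \<le> (cmod c + M) * \<epsilon>"
      if f: "\<forall>x\<in>insert x K. cmod (HL0_apply f x) \<le> \<epsilon>" and \<epsilon>: "0 \<le> \<epsilon>" for f \<epsilon>
    proof -
      have "(c *\<^sub>C delta x + \<psi>) f = c * HL0_apply f x + \<psi> f"
        using step(1) by (simp add: plus_blinfun.rep_eq scaleC_blinfun.rep_eq scaleC_complex_def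
            delta_apply HL0_ext_def)
      also have "cmod \<dots> \<le> cmod c * cmod (HL0_apply f x) + cmod (\<psi> f)"
        using norm_triangle_ineq by (metis norm_mult)
      also have "\<dots> \<le> cmod c * \<epsilon> + M * \<epsilon>"
        using f \<epsilon> by (intro add_mono mult_left_mono M) auto
      finally show ?thesis by (simp add: algebra_simps)
    qed
    then show ?case
      using K step(1) by (intro exI[of _ "insert x K"] exI[of _ "cmod c + M"]) auto
  qed
  have "cmod (\<phi> g - v) \<le> e" if e: "0 < e" for e
  proof -
    define D where "D = \<bar>C\<bar> + norm g + 1"
    have D: "D > 0" by (simp add: D_def add_nonneg_pos)
    \<comment> \<open>Of the total error \<open>e\<close>, one third is for passing from \<open>\<phi>\<close> to the combination \<open>\<psi>\<close>; the rest covers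
        the values of \<open>\<psi>\<close> at \<open>h - g\<close> and of \<open>\<phi>\<close> at \<open>h\<close>.\<close>
    obtain \<psi> where \<psi>: "\<psi> \<in> cspan (delta ` ball 0 1)" "dist \<psi> \<phi> < e / (3 * D)"
      using \<phi> e D unfolding G0_def closure_approachable by (metis divide_pos_pos mult_pos_pos zero_less_numeral)
    obtain K M where K: "finite K" "K \<subseteq> ball 0 1" "0 \<le> M"
      and M: "\<And>f \<epsilon>. (\<forall>x\<in>K. cmod (HL0_apply f x) \<le> \<epsilon>) \<Longrightarrow> 0 \<le> \<epsilon> \<Longrightarrow> cmod (\<psi> f) \<le> M * \<epsilon>"
      using span[OF \<psi>(1)] by blast
    define \<epsilon> where "\<epsilon> = e / (3 * (M + 1))"
    have \<epsilon>: "0 < \<epsilon>" using e K(3) by (simp add: \<epsilon>_def)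
    have "(M + 1) * \<epsilon> = e / 3" using K(3) by (simp add: \<epsilon>_def field_simps)
    then have \<epsilon>3: "M * \<epsilon> + \<epsilon> = e / 3" by (simp add: algebra_simps)
    obtain h where h: "norm h \<le> C" "\<forall>x\<in>K. cmod (HL0_apply h x - HL0_apply g x) \<le> \<epsilon>"
      "cmod (\<phi> h - v) \<le> \<epsilon>"
      using approx[OF K(1,2) \<epsilon>] by blast
    have "norm (h - g) \<le> D" using norm_triangle_ineq4[of h g] h(1) by (simp add: D_def)
    then have "cmod ((\<psi> - \<phi>) (h - g)) \<le> e / (3 * D) * D"
      using \<psi>(2) D e by (intro order_trans[OF norm_blinfun] mult_mono) (auto simp: dist_norm)
    then have 1: "cmod ((\<psi> - \<phi>) (h - g)) \<le> e / 3" using D by simp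
    have 2: "cmod (\<psi> (h - g)) \<le> M * \<epsilon>"
      using h(2) \<epsilon> by (intro M) (auto simp: minus_HL0.rep_eq)
    have "\<phi> g - v = (\<phi> h - v) + (\<psi> - \<phi>) (h - g) - \<psi> (h - g)"
      by (simp add: blinfun.diff_left blinfun.diff_right)
    also have "cmod \<dots> \<le> cmod (\<phi> h - v) + cmod ((\<psi> - \<phi>) (h - g)) + cmod (\<psi> (h - g))"
      by (meson add_mono norm_triangle_ineq norm_triangle_ineq4 order_refl order_trans)
    also have "\<dots> \<le> e" using 1 2 h(3) \<epsilon>3 e by simp
    finally show ?thesis .
  qed
  then have "cmod (\<phi> g - v) \<le> 0" by (meson dense_ge)
  then show ?thesis by simp
qed

section \<open>The barycentre\<close>

lemma contractive_functional_0: "contractive_functional u \<Longrightarrow> u 0 = 0"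
  by (metis contractive_functional_def norm_le_zero_iff norm_zero)

lemma contractive_functional_diff: "contractive_functional u \<Longrightarrow> u (x - y) = u x - u y"
  by (metis add_diff_cancel_right' clinear_iff contractive_functional_def diff_add_cancel)

text \<open>
  The map sending \<open>\<Sum>c\<^sub>i \<delta>(x\<^sub>i)\<close> to \<open>\<Sum>c\<^sub>i x\<^sub>i\<close> does not increase norms, since the norm of the image is
  attained by a contractive functional, which is an element of norm at most 1 of the space of
  holomorphic Lipschitz functions. So approximating combinations have a Cauchy sequence of
  barycentres, and completeness provides the limit.
\<close>

lemma G0_barycenter:
  fixes \<phi> :: "'a :: cbanach HL0 \<Rightarrow>\<^sub>L complex"
  assumes \<phi>: "\<phi> \<in> G0"
  obtains x\<^sub>0 where "\<And>u. contractive_functional u \<Longrightarrow> \<phi> (HL0_of u) = u x\<^sub>0"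
proof -
  have span: "\<exists>x. \<forall>u. contractive_functional u \<longrightarrow> \<psi> (HL0_of u) = u x"
    if "\<psi> \<in> cspan (delta ` ball 0 1)" for \<psi> :: "'a HL0 \<Rightarrow>\<^sub>L complex"
    using that
  proof (induction rule: cspan_delta_induct)
    case zero
    show ?case by (rule exI[of _ 0]) (simp add: contractive_functional_0)
  next
    case (step c x \<psi>)
    then obtain y where y: "\<And>u. contractive_functional u \<Longrightarrow> \<psi> (HL0_of u) = u y" by blast
    have "(c *\<^sub>C delta x + \<psi>) (HL0_of u) = u (c *\<^sub>C x + y)" if u: "contractive_functional u" for u
      using u by (simp add: combination_apply[OF holo_lip_contractive[OF u] step(1)] y
          contractive_functional_0) (simp add: contractive_functional_def clinear_iff scaleC_complex_def)
    then show ?case by blast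
  qed
  obtain \<psi> where \<psi>: "\<And>n :: nat. \<psi> n \<in> cspan (delta ` ball 0 1)" "\<psi> \<longlonglongrightarrow> \<phi>"
    using G0_approx[OF \<phi>] by blast
  have "\<forall>n. \<exists>x. \<forall>u. contractive_functional u \<longrightarrow> \<psi> n (HL0_of u) = u x"
    using span \<psi>(1) by blast
  then obtain x where x: "\<And>n u. contractive_functional u \<Longrightarrow> \<psi> n (HL0_of u) = u (x n)"
    by metis
  have dist: "norm (x m - x n) \<le> norm (\<psi> m - \<psi> n)" for m n
  proof -
    obtain u where u: "contractive_functional u" "u (x m - x n) = of_real (norm (x m - x n))"
      using norming_functional by blast
    have "(\<psi> m - \<psi> n) (HL0_of u) = of_real (norm (x m - x n))"
      using u by (simp add: blinfun.diff_left x contractive_functional_diff)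
    then have "norm (x m - x n) = cmod ((\<psi> m - \<psi> n) (HL0_of u))" by simp
    also have "\<dots> \<le> norm (\<psi> m - \<psi> n) * 1"
      using norm_HL0_of_le[OF holo_lip_contractive[OF u(1)]]
      by (intro order_trans[OF norm_blinfun] mult_left_mono) auto
    finally show ?thesis by simp
  qed
  have "Cauchy \<psi>" using \<psi>(2) by (auto intro: convergent_Cauchy convergentI)
  then have "Cauchy x"
    using dist unfolding Cauchy_def dist_norm by (meson le_less_trans)
  then obtain x\<^sub>0 where lim: "x \<longlonglongrightarrow> x\<^sub>0" using Cauchy_convergent_iff convergent_def by blast
  have "\<phi> (HL0_of u) = u x\<^sub>0" if u: "contractive_functional u" for u
  proof (rule LIMSEQ_unique)
    show "(\<lambda>n. \<psi> n (HL0_of u)) \<longlonglongrightarrow> \<phi> (HL0_of u)" by (intro blinfun.tendsto \<psi>(2) tendsto_const)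
    have "(\<lambda>n. u (x n) - u x\<^sub>0) \<longlonglongrightarrow> 0"
    proof (rule Lim_null_comparison)
      show "\<forall>\<^sub>F n in sequentially. norm (u (x n) - u x\<^sub>0) \<le> norm (x n - x\<^sub>0)"
        using u by (simp add: contractive_functional_def flip: contractive_functional_diff[OF u])
      show "(\<lambda>n. norm (x n - x\<^sub>0)) \<longlonglongrightarrow> 0" using lim tendsto_norm_zero LIM_zero by blast
    qed
    then show "(\<lambda>n. \<psi> n (HL0_of u)) \<longlonglongrightarrow> u x\<^sub>0" unfolding x[OF u] by (rule LIM_zero_cancel)
  qed
  then show ?thesis using that by blast
qed

text \<open>
  If \<open>u\<close> is norming at \<open>x\<^sub>0\<close>, then \<open>(norm x\<^sub>0)\<^sup>n\<close> is the value of the functional at \<open>u\<^sup>n\<close>, whose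
  Lipschitz constant on the ball is at most \<open>n\<close>. Exponential growth is therefore impossible.
\<close>

lemma multiplicative_barycenter_le_1:
  fixes \<phi> :: "'a :: complex_normed_vector HL0 \<Rightarrow>\<^sub>L complex"
  assumes \<phi>: "\<phi> \<in> G0" "multiplicative \<phi>"
    and bary: "\<And>u. contractive_functional u \<Longrightarrow> \<phi> (HL0_of u) = u x\<^sub>0"
  shows "norm x\<^sub>0 \<le> 1"
proof (rule ccontr)
  assume "\<not> norm x\<^sub>0 \<le> 1"
  then have x0: "1 < norm x\<^sub>0" by simp
  obtain u where u: "contractive_functional u" "u x\<^sub>0 = of_real (norm x\<^sub>0)"
    using norming_functional by blast
  note u_lip = holo_lip_contractive[OF u(1)]
  have le1: "cmod (u x) \<le> 1" if "x \<in> ball 0 1" for x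
    using u(1) that by (auto simp: contractive_functional_def intro: order_trans[of _ "norm x"])
  have pow: "holo_lip (real n) (\<lambda>x. u x ^ n) \<and> unital_extension \<phi> (\<lambda>x. u x ^ n) = u x\<^sub>0 ^ n" for n
  proof (induction n)
    case 0
    show ?case by (simp add: holo_lip_const unital_extension_const)
  next
    case (Suc n)
    then have IH: "holo_lip (real n) (\<lambda>x. u x ^ n)" by blast
    have "holo_lip (1 * real n + 1 * 1) (\<lambda>x. u x * u x ^ n)"
      using le1 by (intro holo_lip_mult[OF u_lip IH]) (auto simp: norm_power power_le_one)
    moreover have "unital_extension \<phi> (\<lambda>x. u x * u x ^ n) = unital_extension \<phi> u * u x\<^sub>0 ^ n"
      using unital_extension_mult[OF \<phi> u_lip IH] Suc by simp
    moreover have "unital_extension \<phi> u = u x\<^sub>0"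
      using bary[OF u(1)] by (simp add: unital_extension_def contractive_functional_0[OF u(1)])
    ultimately show ?case by (simp add: add.commute)
  qed
  define q where "q = inverse (norm x\<^sub>0)"
  have q: "0 < q" "q < 1" using x0 by (auto simp: q_def inverse_less_1_iff)
  have "1 \<le> q ^ n + norm \<phi> * (real n * q ^ n)" for n
  proof -
    have "norm x\<^sub>0 ^ n = cmod (unital_extension \<phi> (\<lambda>x. u x ^ n))"
      using pow[of n] u(2) by (simp add: norm_power)
    also have "\<dots> \<le> cmod (u 0 ^ n) + norm \<phi> * real n"
      unfolding unital_extension_def
    proof (intro order_trans[OF norm_triangle_ineq] add_left_mono)
      show "cmod (\<phi> (HL0_of (\<lambda>x. u x ^ n))) \<le> norm \<phi> * real n"
        using norm_HL0_of_le pow by (intro order_trans[OF norm_blinfun] mult_left_mono) auto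
    qed
    also have "cmod (u 0 ^ n) \<le> 1"
      by (simp add: norm_power power_le_one contractive_functional_0[OF u(1)])
    finally have "norm x\<^sub>0 ^ n * q ^ n \<le> (1 + norm \<phi> * real n) * q ^ n"
      using q by (intro mult_right_mono) auto
    moreover have "norm x\<^sub>0 * q = 1" using x0 unfolding q_def by (intro right_inverse) auto
    then have "norm x\<^sub>0 ^ n * q ^ n = 1" by (metis power_mult_distrib power_one)
    ultimately show ?thesis by (simp add: algebra_simps)
  qed
  moreover have "(\<lambda>n. q ^ n + norm \<phi> * (real n * q ^ n)) \<longlonglongrightarrow> 0 + norm \<phi> * 0"
    using q powser_times_n_limit_0[of q]
    by (intro tendsto_add tendsto_mult tendsto_const LIMSEQ_power_zero) auto
  ultimately have "1 \<le> 0 + norm \<phi> * 0"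
    by (intro LIMSEQ_le_const) auto
  then show False by simp
qed

section \<open>Functions of finitely many linear functionals\<close>

text \<open>
  The operator \<open>\<Sum>u\<^sub>i \<otimes> b\<^sub>i\<close>. A list rather than a set of pairs allows repetitions and provides the
  induction on the number of variables.
\<close>

definition rank_sum :: "(('a \<Rightarrow> complex) \<times> 'b :: complex_normed_vector) list \<Rightarrow> 'a \<Rightarrow> 'b" where
  "rank_sum us x = (\<Sum>(u, b)\<leftarrow>us. u x *\<^sub>C b)"

definition weight :: "(('a \<Rightarrow> complex) \<times> 'b :: complex_normed_vector) list \<Rightarrow> real" where
  "weight us = (\<Sum>(u, b)\<leftarrow>us. norm b)"

lemma rank_sum_simps [simp]:
  "rank_sum [] x = 0" "rank_sum ((u, b) # us) x = u x *\<^sub>C b + rank_sum us x"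
  by (simp_all add: rank_sum_def)

lemma weight_simps [simp]: "weight [] = 0" "weight ((u, b) # us) = norm b + weight us"
  by (simp_all add: weight_def)

lemma weight_nonneg: "0 \<le> weight us"
  by (auto simp: weight_def intro!: sum_list_nonneg)

lemma clinear_rank_sum:
  assumes "\<forall>p\<in>set us. contractive_functional (fst p)"
  shows "clinear (rank_sum us)"
  using assms
proof (induction us)
  case Nil
  show ?case by (simp add: clinear_iff)
next
  case (Cons p us)
  obtain u b where p: "p = (u, b)" by (cases p)
  then have "clinear u" using Cons by (auto simp: contractive_functional_def)
  moreover have "clinear (rank_sum us)" using Cons by auto
  ultimately show ?case
    by (simp add: p clinear_iff scaleC_add_left scaleC_add_right scaleC_scaleC scaleC_complex_def)
qed

lemma norm_rank_sum_le:
  assumes "\<forall>p\<in>set us. contractive_functional (fst p)"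
  shows "norm (rank_sum us x) \<le> weight us * norm x"
  using assms
proof (induction us)
  case (Cons p us)
  obtain u b where p: "p = (u, b)" by (cases p)
  then have "cmod (u x) \<le> norm x" using Cons by (auto simp: contractive_functional_def)
  then have "norm (u x *\<^sub>C b) \<le> norm x * norm b" by (simp add: norm_scaleC mult_right_mono)
  moreover have "norm (rank_sum us x) \<le> weight us * norm x" using Cons by auto
  ultimately show ?case
    using norm_triangle_ineq[of "u x *\<^sub>C b" "rank_sum us x"] by (simp add: p algebra_simps)
qed simp

lemma scaleC_rank_sum: "z *\<^sub>C rank_sum us x = rank_sum (map (\<lambda>(u, b). (u, z *\<^sub>C b)) us) x"
  by (induction us) (auto simp: scaleC_add_right scaleC_scaleC mult.commute)

lemma weight_scale: "weight (map (\<lambda>(u, b). (u, z *\<^sub>C b)) us) = cmod z * weight us"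
  by (induction us) (auto simp: norm_scaleC algebra_simps)

lemma contractive_functional_uminus:
  "contractive_functional u \<Longrightarrow> contractive_functional (\<lambda>x. - u x)"
  by (simp add: contractive_functional_def clinear_iff scaleC_complex_def)

text \<open>
  The reciprocal of \<open>z - u\<close> lies in the algebra, and a unital multiplicative functional preserves
  reciprocals. The circle of radius 2 stays at distance at least 1 from the values of \<open>u\<close>.
\<close>

lemma unital_extension_resolvent:
  assumes \<phi>: "\<phi> \<in> G0" "multiplicative \<phi>"
    and u: "contractive_functional u" and bary: "\<phi> (HL0_of (\<lambda>x. - u x)) = - a"
    and z: "2 \<le> cmod z"
  shows "holo_lip 1 (\<lambda>x. inverse (z - u x))"
    and "x \<in> ball 0 1 \<Longrightarrow> cmod (inverse (z - u x)) \<le> 1"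
    and "unital_extension \<phi> (\<lambda>x. inverse (z - u x)) = inverse (z - a)"
proof -
  have ge: "1 \<le> cmod (z - u x)" if "x \<in> ball 0 1" for x
  proof -
    have "cmod (u x) \<le> 1" using u that by (auto simp: contractive_functional_def intro: order_trans[of _ "norm x"])
    then show ?thesis using norm_triangle_ineq2[of z "u x"] z by simp
  qed
  note neg = holo_lip_contractive[OF contractive_functional_uminus[OF u]]
  have w: "holo_lip 1 (\<lambda>x. z - u x)"
    using holo_lip_add[OF holo_lip_const[of z] neg] by simp
  show inv: "holo_lip 1 (\<lambda>x. inverse (z - u x))" using holo_lip_inverse[OF w ge] .
  show "cmod (inverse (z - u x)) \<le> 1" if "x \<in> ball 0 1"
    using ge[OF that] by (simp add: norm_inverse inverse_le_1_iff)
  have "unital_extension \<phi> (\<lambda>x. z - u x) = z - a"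
    using unital_extension_add[OF holo_lip_const[of z] neg, of \<phi>] bary
    by (simp add: unital_extension_const) (simp add: unital_extension_def contractive_functional_0[OF u])
  then have "unital_extension \<phi> (\<lambda>x. inverse (z - u x)) * (z - a)
      = unital_extension \<phi> (\<lambda>x. inverse (z - u x) * (z - u x))"
    using unital_extension_mult[OF \<phi> inv w] by simp
  also have "\<dots> = unital_extension \<phi> (\<lambda>x. 1)"
    by (rule unital_extension_cong) (use ge in \<open>fastforce intro: left_inverse\<close>)
  finally have eq: "unital_extension \<phi> (\<lambda>x. inverse (z - u x)) * (z - a) = 1"
    by (simp add: unital_extension_const)
  then have "z - a \<noteq> 0" by auto
  then show "unital_extension \<phi> (\<lambda>x. inverse (z - u x)) = inverse (z - a)"
    using eq by (simp add: field_simps)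
qed

text \<open>
  Induction on the number of summands. With \<open>v\<close> for the remaining summands, Cauchy's formula on the
  circle of radius 2 represents \<open>f (y + u x b + v x)\<close> as the integral of
  \<open>f (y + zb + v x)/(z - u x)\<close>. Applied under the integral, the functional turns the first factor into
  \<open>f (y + zb + v x\<^sub>0)\<close> by the induction hypothesis for the centre \<open>y + zb\<close> and the second into
  \<open>1/(z - u x\<^sub>0)\<close>; Cauchy's formula at \<open>u x\<^sub>0\<close> then evaluates the integral. The factor 2 in the
  smallness condition is the radius of the circle: it keeps \<open>y + zb + v x\<close> inside the ball.
\<close>

lemma unital_extension_rank_sum:
  fixes \<phi> :: "'a :: complex_normed_vector HL0 \<Rightarrow>\<^sub>L complex"
  assumes \<phi>: "\<phi> \<in> G0" "multiplicative \<phi>" and x0: "x\<^sub>0 \<in> cball 0 1"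
    and bary: "\<And>u. contractive_functional u \<Longrightarrow> \<phi> (HL0_of u) = u x\<^sub>0"
    and f: "holo_lip C f" and us: "\<forall>p\<in>set us. contractive_functional (fst p)"
    and small: "norm y + 2 * weight us < 1"
  shows "unital_extension \<phi> (\<lambda>x. f (y + rank_sum us x)) = f (y + rank_sum us x\<^sub>0)"
  using us small
proof (induction us arbitrary: y)
  case Nil
  show ?case by (simp add: unital_extension_const)
next
  case (Cons p us)
  obtain u b where p: "p = (u, b)" by (cases p)
  have u: "contractive_functional u" and us: "\<forall>p\<in>set us. contractive_functional (fst p)"
    using Cons.prems(1) by (auto simp: p)
  have small: "norm y + 2 * norm b + 2 * weight us < 1"
    using Cons.prems(2) by (simp add: p)
  let ?v = "rank_sum us"
  have v: "norm (?v x) \<le> weight us" if "x \<in> cball 0 1" for x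
    using norm_rank_sum_le[OF us, of x] weight_nonneg[of us] that
    by (auto intro: order_trans mult_left_le)
  have zb: "norm (z *\<^sub>C b) \<le> 2 * norm b" if "cmod z \<le> 2" for z
    using that by (simp add: norm_scaleC mult_right_mono)
  have ball: "y + z *\<^sub>C b + ?v x \<in> ball 0 1" if z: "cmod z \<le> 2" and x: "x \<in> cball 0 1" for z x
    using norm_triangle_ineq[of "y + z *\<^sub>C b" "?v x"] norm_triangle_ineq[of y "z *\<^sub>C b"]
      zb[OF z] v[OF x] small weight_nonneg[of us] by simp
  have u1: "cmod (u x) \<le> 1" if "x \<in> cball 0 1" for x
    using u that by (auto simp: contractive_functional_def intro: order_trans[of _ "norm x"])
  have IH: "unital_extension \<phi> (\<lambda>x. f (y + z *\<^sub>C b + ?v x)) = f (y + z *\<^sub>C b + ?v x\<^sub>0)"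
    if "cmod z \<le> 2" for z
    using norm_triangle_ineq[of y "z *\<^sub>C b"] zb[OF that] small by (intro Cons.IH us) auto
  have lip: "holo_lip (C * weight us) (\<lambda>x. f (y + z *\<^sub>C b + ?v x))" if "cmod z \<le> 2" for z
    using ball[OF that] ball_subset_cball
    by (intro holo_lip_affine[OF f clinear_rank_sum[OF us] norm_rank_sum_le[OF us] weight_nonneg]) auto
  have bary': "\<phi> (HL0_of (\<lambda>x. - u x)) = - u x\<^sub>0" by (intro bary contractive_functional_uminus u)
  note resolvent = unital_extension_resolvent[OF \<phi> u bary']
  define h where "h z x = f (y + z *\<^sub>C b + ?v x) * inverse (z - u x)" for z x
  define g where "g x = f (y + (u x *\<^sub>C b + ?v x))" for x
  have h_lip: "holo_lip ((cmod (f 0) + C) * 1 + C * weight us * 1) (h z)" if "z \<in> sphere 0 2" for z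
  proof -
    have z: "cmod z \<le> 2" "2 \<le> cmod z" using that by auto
    show ?thesis
      unfolding h_def using holo_lip_bound[OF f] ball[OF z(1)] ball_subset_cball
      by (intro holo_lip_mult[OF lip[OF z(1)] resolvent(1)[OF z(2)]] resolvent(2)[OF z(2)]) auto
  qed
  have h: "unital_extension \<phi> (h z) = f (y + z *\<^sub>C b + ?v x\<^sub>0) / (z - u x\<^sub>0)" if "z \<in> sphere 0 2" for z
  proof -
    have z: "cmod z \<le> 2" "2 \<le> cmod z" using that by auto
    show ?thesis
      unfolding h_def unital_extension_mult[OF \<phi> lip[OF z(1)] resolvent(1)[OF z(2)]]
      by (simp add: IH[OF z(1)] resolvent(3)[OF z(2)] divide_inverse)
  qed
  have hol: "(\<lambda>z. f (y + z *\<^sub>C b + ?v x)) holomorphic_on cball 0 2" if x: "x \<in> cball 0 1" for x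
  proof -
    have "(\<lambda>z. f ((y + ?v x) + z *\<^sub>C b)) holomorphic_on cball 0 2"
      using ball[OF _ x] by (intro holo_lip_holomorphic_on_line[OF f]) (auto simp: algebra_simps)
    then show ?thesis by (simp add: algebra_simps)
  qed
  have Cauchy: "((\<lambda>z. f (y + z *\<^sub>C b + ?v x) / (z - u x)) has_contour_integral
      2 * of_real pi * \<i> * g x) (circlepath 0 2)" if x: "x \<in> cball 0 1" for x
    using Cauchy_integral_circlepath_simple[OF hol[OF x], of "u x"] u1[OF x]
    by (simp add: g_def add.assoc)
  have g_lip: "holo_lip (C * weight (p # us)) g"
  proof -
    have "y + rank_sum (p # us) x \<in> ball 0 1" if "x \<in> ball 0 1" for x
      using ball[of "u x" x] u1[of x] that by (simp add: p add.assoc)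
    then have "holo_lip (C * weight (p # us)) (\<lambda>x. f (y + rank_sum (p # us) x))"
      using Cons.prems(1)
      by (intro holo_lip_affine[OF f clinear_rank_sum norm_rank_sum_le weight_nonneg]) auto
    then show ?thesis by (simp add: p g_def[abs_def])
  qed
  let ?c = "2 * of_real pi * \<i> :: complex"
  have c_lip: "holo_lip (cmod ?c * (C * weight (p # us)) + 0 * (cmod (g 0) + C * weight (p # us))) (\<lambda>x. ?c * g x)"
    using holo_lip_bound[OF g_lip] by (intro holo_lip_mult[OF holo_lip_const g_lip]) auto
  have "((\<lambda>z. unital_extension \<phi> (h z)) has_contour_integral unital_extension \<phi> (\<lambda>x. ?c * g x))
      (circlepath 0 2)"
  proof (rule unital_extension_contour_integral[OF \<phi>(1) _ h_lip c_lip])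
    show "((\<lambda>z. h z x) has_contour_integral ?c * g x) (circlepath 0 2)" if "x \<in> ball 0 1" for x
      using Cauchy[of x] that by (simp add: h_def divide_inverse)
  qed auto
  moreover have "((\<lambda>z. unital_extension \<phi> (h z)) has_contour_integral ?c * g x\<^sub>0) (circlepath 0 2)"
    by (rule has_contour_integral_eq[OF Cauchy[OF x0]]) (simp add: h)
  ultimately have "unital_extension \<phi> (\<lambda>x. ?c * g x) = ?c * g x\<^sub>0"
    using has_contour_integral_unique by blast
  then have "unital_extension \<phi> g = g x\<^sub>0"
    using unital_extension_mult[OF \<phi> holo_lip_const[of ?c] g_lip] by (simp add: unital_extension_const)
  then show ?case by (simp add: p g_def[abs_def])
qed

text \<open>
  A direction \<open>b\<close> is split off by means of a functional \<open>w\<close> norming at \<open>b\<close>: the projection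
  \<open>P y = y - (w y / norm b) b\<close> kills \<open>b\<close>, so that \<open>P \<circ> T\<close> has its range in the span of the images of
  the other spanning vectors. Every coefficient functional is thereby bounded by construction,
  and no topology of finite-dimensional subspaces enters. Division by zero makes \<open>P\<close> the identity
  when \<open>b = 0\<close>, so that this case needs no separate treatment.
\<close>

lemma finite_rank_decomposition:
  fixes T :: "'a :: complex_normed_vector \<Rightarrow> 'b :: complex_normed_vector"
  assumes "finite B" "range T \<subseteq> cspan B" "clinear T" "0 < K" "\<And>x. norm (T x) \<le> K * norm x"
  obtains us where "\<forall>p\<in>set us. contractive_functional (fst p)" "T = rank_sum us"
proof -
  have "\<exists>us. (\<forall>p\<in>set us. contractive_functional (fst p)) \<and> T = rank_sum us"
    using assms
  proof (induction "card B" arbitrary: B T K rule: less_induct)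
    case less
    show ?case
    proof (cases "B = {}")
      case True
      then have "T x = 0" for x using less.prems(2) by auto
      then have "T = rank_sum []" by auto
      then show ?thesis by (metis empty_iff empty_set)
    next
      case False
      then obtain b where b: "b \<in> B" by blast
      obtain w where w: "contractive_functional w" "w b = of_real (norm b)"
        using norming_functional by blast
      have wlin: "w (x + y) = w x + w y" "w (c *\<^sub>C x) = c * w x" and wle: "cmod (w x) \<le> norm x" for x y c
        using w(1) by (auto simp: contractive_functional_def clinear_iff scaleC_complex_def)
      define P where "P y = y - (w y / of_real (norm b)) *\<^sub>C b" for y
      have P: "clinear P"
        by (simp add: P_def clinear_iff wlin add_divide_distrib scaleC_add_left
            complex_vector.scale_right_diff_distrib scaleC_scaleC)
      have Pb: "P b = 0"
        by (cases "b = 0") (simp_all add: P_def w(2) scaleC_one)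
      have Ple: "norm (P y) \<le> 2 * norm y" for y
      proof -
        have "norm ((w y / of_real (norm b)) *\<^sub>C b) \<le> norm y"
          using wle[of y] by (cases "b = 0") (simp_all add: norm_scaleC norm_divide)
        then show ?thesis using norm_triangle_ineq4[of y "(w y / of_real (norm b)) *\<^sub>C b"]
          by (simp add: P_def)
      qed
      let ?B = "P ` (B - {b})"
      have "range (\<lambda>x. P (T x)) \<subseteq> P ` cspan B" using less.prems(2) by auto
      also have "P ` cspan B = cspan (P ` B)"
        using P unfolding cspan_def by (simp add: linear_iff_module_hom module_hom.span_image)
      also have "P ` B = insert 0 ?B" using b Pb by auto
      finally have range: "range (\<lambda>x. P (T x)) \<subseteq> cspan ?B"
        by simp
      have card: "card ?B < card B"
        using card_image_le[of "B - {b}" P] less.prems(1) b by (meson card_Diff1_less finite_Diff le_less_trans)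
      have lin: "clinear (\<lambda>x. P (T x))" using P less.prems(3) by (simp add: clinear_iff)
      have bd: "norm (P (T x)) \<le> 2 * K * norm x" for x
        using Ple[of "T x"] less.prems(5)[of x] by simp
      obtain us where us: "\<forall>p\<in>set us. contractive_functional (fst p)"
        "(\<lambda>x. P (T x)) = rank_sum us"
        using less.hyps[OF card _ range lin _ bd] less.prems(1,4) by auto
      \<comment> \<open>Dividing by \<open>K\<close> makes the coefficient contractive; the vector absorbs the factor.\<close>
      define u where "u x = w (T x) / of_real K" for x
      have "cmod (u x) \<le> norm x" for x
        using wle[of "T x"] less.prems(5)[of x] less.prems(4)
        by (simp add: u_def norm_divide divide_le_eq mult.commute)
      then have u: "contractive_functional u"
        using less.prems(3) by (simp add: contractive_functional_def u_def clinear_iff wlin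
            add_divide_distrib scaleC_complex_def)
      have "T x = rank_sum ((u, (of_real K / of_real (norm b)) *\<^sub>C b) # us) x" for x
      proof -
        have "T x = (w (T x) / of_real (norm b)) *\<^sub>C b + P (T x)" by (simp add: P_def)
        also have "P (T x) = rank_sum us x" by (rule fun_cong[OF us(2)])
        also have "w (T x) / of_real (norm b) = u x * (of_real K / of_real (norm b))"
          using less.prems(4) by (simp add: u_def)
        finally show ?thesis by (simp add: scaleC_scaleC)
      qed
      then show ?thesis
        using us(1) u by (intro exI[of _ "(u, (of_real K / of_real (norm b)) *\<^sub>C b) # us"]) auto
    qed
  qed
  then show ?thesis using that by blast
qed

section \<open>From finite rank to the identity\<close>

lemma holo_lip_dilation:
  fixes A :: "'a :: complex_normed_vector \<Rightarrow> 'b :: complex_normed_vector"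
  assumes f: "holo_lip C f" and A: "clinear A" "\<And>x. norm (A x) \<le> R * norm x"
    and z: "cmod z * R \<le> 1"
  shows "holo_lip C (\<lambda>x. f (z *\<^sub>C A x))"
proof -
  have le: "norm (z *\<^sub>C A x) \<le> 1 * norm x" for x
  proof -
    have "norm (z *\<^sub>C A x) \<le> cmod z * (R * norm x)"
      using A(2) by (simp add: norm_scaleC mult_left_mono)
    also have "\<dots> \<le> 1 * norm x" using mult_right_mono[OF z norm_ge_zero[of x]] by (simp add: mult.assoc)
    finally show ?thesis .
  qed
  have "0 + z *\<^sub>C A x \<in> ball 0 1" if "x \<in> ball 0 1" for x
    using le[of x] that by simp
  then show ?thesis
    using holo_lip_affine[OF f clinear_compose_scale[OF A(1)] le, of 0] by simp
qed

text \<open>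
  Both sides are holomorphic in \<open>z\<close> on the disc of radius \<open>1/R\<close>, the left one because \<open>\<phi>\<close> is in
  \<^const>\<open>G0\<close> and the functions \<open>x \<mapsto> f (z A x)\<close> share the Lipschitz constant of \<open>f\<close>.
\<close>

lemma dilation_continuation:
  fixes \<phi> :: "'a :: complex_normed_vector HL0 \<Rightarrow>\<^sub>L complex"
  assumes \<phi>: "\<phi> \<in> G0" and x0: "x\<^sub>0 \<in> cball 0 1" and f: "holo_lip C f"
    and A: "clinear A" "\<And>x. norm (A x) \<le> R * norm x" and R: "0 < R" and \<epsilon>: "0 < \<epsilon>"
    and small: "\<And>z. cmod z < \<epsilon> \<Longrightarrow> unital_extension \<phi> (\<lambda>x. f (z *\<^sub>C A x)) = f (z *\<^sub>C A x\<^sub>0)"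
    and z: "cmod z * R < 1"
  shows "unital_extension \<phi> (\<lambda>x. f (z *\<^sub>C A x)) = f (z *\<^sub>C A x\<^sub>0)"
proof (rule analytic_continuation_open[of "ball 0 (min \<epsilon> (1 / R))" "ball 0 (1 / R)"
      "\<lambda>z. unital_extension \<phi> (\<lambda>x. f (z *\<^sub>C A x))" "\<lambda>z. f (z *\<^sub>C A x\<^sub>0)" z])
  have in_disc: "cmod z * R < 1" if "z \<in> ball 0 (1 / R)" for z
    using that R by (simp add: field_simps)
  have hol: "(\<lambda>z. f (z *\<^sub>C A x)) holomorphic_on ball 0 (1 / R)" if x: "x \<in> cball 0 1" for x
  proof -
    have "0 + z *\<^sub>C A x \<in> ball 0 1" if z: "z \<in> ball 0 (1 / R)" for z
    proof -
      have "norm (z *\<^sub>C A x) \<le> cmod z * (R * norm x)"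
        using A(2) by (simp add: norm_scaleC mult_left_mono)
      also have "\<dots> \<le> cmod z * R" using R x by (simp add: mult_left_mono mult_left_le)
      finally show ?thesis using in_disc[OF z] by simp
    qed
    then have "(\<lambda>z. f (0 + z *\<^sub>C A x)) holomorphic_on ball 0 (1 / R)"
      by (rule holo_lip_holomorphic_on_line[OF f])
    then show ?thesis by simp
  qed
  show "(\<lambda>z. f (z *\<^sub>C A x\<^sub>0)) holomorphic_on ball 0 (1 / R)" using hol x0 .
  show "(\<lambda>z. unital_extension \<phi> (\<lambda>x. f (z *\<^sub>C A x))) holomorphic_on ball 0 (1 / R)"
  proof (rule unital_extension_holomorphic[OF \<phi>])
    show "holo_lip C (\<lambda>x. f (z *\<^sub>C A x))" if "z \<in> ball 0 (1 / R)" for z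
      using in_disc[OF that] by (intro holo_lip_dilation[OF f A]) auto
  qed (use hol ball_subset_cball in auto)
  show "z \<in> ball 0 (1 / R)" using z R by (simp add: field_simps)
qed (use R \<epsilon> small in \<open>auto simp: min_le_iff_disj\<close>)

text \<open>
  The disc on which the cylinder case applies depends on the chosen decomposition of \<open>T\<close>; analytic
  continuation replaces it by one that depends only on the bound \<open>M\<close>.
\<close>

lemma unital_extension_finite_rank:
  fixes \<phi> :: "'a :: complex_normed_vector HL0 \<Rightarrow>\<^sub>L complex"
    and T :: "'a \<Rightarrow> 'b :: complex_normed_vector"
  assumes \<phi>: "\<phi> \<in> G0" "multiplicative \<phi>" and x0: "x\<^sub>0 \<in> cball 0 1"
    and bary: "\<And>u. contractive_functional u \<Longrightarrow> \<phi> (HL0_of u) = u x\<^sub>0"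
    and f: "holo_lip C f"
    and T: "clinear T" "\<And>x. norm (T x) \<le> M * norm x" "range T \<subseteq> cspan B" "finite B"
    and M: "0 < M" and z: "cmod z * M < 1"
  shows "unital_extension \<phi> (\<lambda>x. f (z *\<^sub>C T x)) = f (z *\<^sub>C T x\<^sub>0)"
proof -
  obtain us where us: "\<forall>p\<in>set us. contractive_functional (fst p)" "T = rank_sum us"
    using finite_rank_decomposition[OF T(4,3,1) M T(2)] by blast
  define \<epsilon> where "\<epsilon> = 1 / (2 * weight us + 1)"
  have \<epsilon>: "0 < \<epsilon>" using weight_nonneg[of us] by (simp add: \<epsilon>_def)
  have "unital_extension \<phi> (\<lambda>x. f (z *\<^sub>C T x)) = f (z *\<^sub>C T x\<^sub>0)" if z: "cmod z < \<epsilon>" for z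
  proof -
    let ?us = "map (\<lambda>(u, b). (u, z *\<^sub>C b)) us"
    have "cmod z * (2 * weight us + 1) < 1"
      using z weight_nonneg[of us] by (simp add: \<epsilon>_def less_divide_eq)
    then have "norm (0 :: 'b) + 2 * weight ?us < 1"
      by (simp add: weight_scale algebra_simps) (smt (verit) norm_ge_zero)
    moreover have "\<forall>p\<in>set ?us. contractive_functional (fst p)"
      using us(1) by (auto split: prod.splits)
    ultimately have "unital_extension \<phi> (\<lambda>x. f (0 + rank_sum ?us x)) = f (0 + rank_sum ?us x\<^sub>0)"
      by (intro unital_extension_rank_sum[OF \<phi> x0 bary f])
    then show ?thesis by (simp add: us(2) scaleC_rank_sum)
  qed
  then show ?thesis
    using dilation_continuation[OF \<phi>(1) x0 f T(1,2) M \<epsilon> _ z] by blast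
qed

text \<open>
  For \<open>\<bar>z\<bar> < 1/M\<close> the functions \<open>x \<mapsto> f (z T x)\<close>, with \<open>T\<close> running through the approximating operators,
  are Lipschitz with the constant of \<open>f\<close> and approximate \<open>x \<mapsto> f (z x)\<close> on finite sets. Including
  \<open>x\<^sub>0\<close> in the compact set controls the other side of the equation as well.
\<close>

lemma unital_extension_dilation:
  fixes \<phi> :: "'a :: cbanach HL0 \<Rightarrow>\<^sub>L complex"
  assumes bap: "bounded_approximation_property TYPE('a)"
    and \<phi>: "\<phi> \<in> G0" "multiplicative \<phi>" and x0: "x\<^sub>0 \<in> cball 0 1"
    and bary: "\<And>u. contractive_functional u \<Longrightarrow> \<phi> (HL0_of u) = u x\<^sub>0"
    and f: "holo_lip C f" and z: "cmod z < 1"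
  shows "unital_extension \<phi> (\<lambda>x. f (z *\<^sub>C x)) = f (z *\<^sub>C x\<^sub>0)"
proof -
  obtain M where M: "0 < M" and approx: "\<forall>K :: 'a set. compact K \<longrightarrow> (\<forall>\<epsilon>>0. \<exists>T :: 'a \<Rightarrow>\<^sub>L 'a.
        clinear (blinfun_apply T) \<and> (\<exists>B. finite B \<and> range (blinfun_apply T) \<subseteq> cspan B) \<and>
        norm T \<le> M \<and> (\<forall>x\<in>K. norm (blinfun_apply T x - x) < \<epsilon>))"
    using bap unfolding bounded_approximation_property_def by (elim exE conjE) (rule that)
  have id: "clinear (\<lambda>x :: 'a. x)" by (simp add: clinear_iff)
  have C: "0 \<le> C" using holo_lip_nonneg[OF f] .
  \<comment> \<open>The minimum with 1 matters only for \<open>M < 1\<close>, where \<open>z x\<close> could leave the ball.\<close>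
  define r where "r = min 1 (1 / M)"
  have r: "0 < r" "r \<le> 1" "r * M \<le> 1" using M by (auto simp: r_def min_def field_simps)
  have small: "unital_extension \<phi> (\<lambda>x. f (z *\<^sub>C x)) = f (z *\<^sub>C x\<^sub>0)" if z: "cmod z < r" for z
  proof -
    have zM: "cmod z * M < 1" using mult_strict_right_mono[OF z M] r by simp
    have z1: "cmod z < 1" using z r by simp
    let ?g = "\<lambda>x. f (z *\<^sub>C x)"
    have g: "holo_lip C ?g" using z1 by (intro holo_lip_dilation[OF f id, of 1]) auto
    have "\<phi> (HL0_of ?g) = f (z *\<^sub>C x\<^sub>0) - f 0"
    proof (rule G0_eqI[OF \<phi>(1), where C = C])
      fix K :: "'a set" and \<epsilon> :: real
      assume K: "finite K" "K \<subseteq> ball 0 1" and \<epsilon>: "0 < \<epsilon>"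
      have K': "compact (insert x\<^sub>0 K)" using K(1) by (simp add: finite_imp_compact)
      have \<epsilon>': "0 < \<epsilon> / (C + 1)" using \<epsilon> C by simp
      from approx[rule_format, OF K' \<epsilon>'] obtain T B where T: "clinear (blinfun_apply T)"
        and B: "finite B" "range (blinfun_apply T) \<subseteq> cspan B" and "norm T \<le> M"
        and near: "\<forall>x\<in>insert x\<^sub>0 K. norm (blinfun_apply T x - x) < \<epsilon> / (C + 1)"
        by (elim exE conjE) (rule that)
      have TM: "norm (T x) \<le> M * norm x" for x
        using norm_blinfun[of T x] mult_right_mono[OF \<open>norm T \<le> M\<close> norm_ge_zero[of x]] by linarith
      have ball: "z *\<^sub>C T x \<in> ball 0 1" "z *\<^sub>C x \<in> ball 0 1" if x: "x \<in> cball 0 1" for x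
      proof -
        have "cmod z * norm (T x) \<le> cmod z * (M * norm x)" using TM by (simp add: mult_left_mono)
        also have "\<dots> \<le> cmod z * M" using M x by (simp add: mult_left_mono mult_left_le)
        finally show "z *\<^sub>C T x \<in> ball 0 1" using zM by (simp add: norm_scaleC)
        have "cmod z * norm x \<le> cmod z" using x by (simp add: mult_left_le)
        then show "z *\<^sub>C x \<in> ball 0 1" using z1 by (simp add: norm_scaleC)
      qed
      have close: "cmod (f (z *\<^sub>C T x) - f (z *\<^sub>C x)) \<le> \<epsilon>" if x: "x \<in> insert x\<^sub>0 K" for x
      proof -
        have "x \<in> cball 0 1" using x x0 K(2) ball_subset_cball by auto
        then have "cmod (f (z *\<^sub>C T x) - f (z *\<^sub>C x)) \<le> C * norm (z *\<^sub>C T x - z *\<^sub>C x)"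
          using ball by (intro holo_lip_dist[OF f])
        also have "\<dots> = C * (cmod z * norm (T x - x))"
          by (simp add: norm_scaleC flip: complex_vector.scale_right_diff_distrib)
        also have "\<dots> \<le> C * (1 * (\<epsilon> / (C + 1)))"
          using C z1 bspec[OF near x] by (intro mult_left_mono mult_mono) auto
        also have "\<dots> \<le> \<epsilon>" using C \<epsilon> by (simp add: field_simps)
        finally show ?thesis .
      qed
      let ?h = "\<lambda>x. f (z *\<^sub>C T x)"
      have h: "holo_lip C ?h" using zM by (intro holo_lip_dilation[OF f T TM]) auto
      have T0: "T 0 = 0" by (rule blinfun.zero_right)
      have "\<forall>x\<in>K. cmod (HL0_apply (HL0_of ?h) x - HL0_apply (HL0_of ?g) x) \<le> \<epsilon>"
        using close K(2) by (auto simp: HL0_apply_HL0_of[OF h] HL0_apply_HL0_of[OF g] T0)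
      moreover have "unital_extension \<phi> ?h = f (z *\<^sub>C T x\<^sub>0)"
        by (rule unital_extension_finite_rank[OF \<phi> x0 bary f T TM B(2,1) M zM])
      then have "cmod (\<phi> (HL0_of ?h) - (f (z *\<^sub>C x\<^sub>0) - f 0)) \<le> \<epsilon>"
        using close[of x\<^sub>0] by (simp add: unital_extension_def T0 algebra_simps)
      ultimately show "\<exists>h. norm h \<le> C \<and> (\<forall>x\<in>K. cmod (HL0_apply h x - HL0_apply (HL0_of ?g) x) \<le> \<epsilon>) \<and>
          cmod (\<phi> h - (f (z *\<^sub>C x\<^sub>0) - f 0)) \<le> \<epsilon>"
        using norm_HL0_of_le[OF h] by blast
    qed
    then show ?thesis by (simp add: unital_extension_def)
  qed
  show ?thesis
    using dilation_continuation[OF \<phi>(1) x0 f id _ zero_less_one r(1) small, of z] z by simp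
qed

theorem proposition3p10:
  fixes \<phi> :: "('a :: cbanach) HL0 \<Rightarrow>\<^sub>L complex"
  assumes "bounded_approximation_property TYPE('a)"
    and "\<phi> \<in> G0"
    and "multiplicative \<phi>"
  shows "\<exists>x\<^sub>0 \<in> cball (0 :: 'a) 1. \<phi> = delta x\<^sub>0"
proof -
  obtain x\<^sub>0 where bary: "\<And>u. contractive_functional u \<Longrightarrow> \<phi> (HL0_of u) = u x\<^sub>0"
    using G0_barycenter[OF assms(2)] by blast
  have x0: "x\<^sub>0 \<in> cball 0 1"
    using multiplicative_barycenter_le_1[OF assms(2,3) bary] by simp
  have "\<phi> g = delta x\<^sub>0 g" for g
  proof (rule G0_eqI[OF assms(2), where C = "norm g"])
    fix K :: "'a set" and \<epsilon> :: real
    assume K: "K \<subseteq> ball 0 1" and \<epsilon>: "0 < \<epsilon>"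
    \<comment> \<open>Chosen such that \<open>norm g * (1 - r) \<le> \<epsilon>\<close>: shrinking by \<open>r\<close> moves values of \<open>g\<close> by at most \<open>\<epsilon>\<close>.\<close>
    define r where "r = max 0 (1 - \<epsilon> / (norm g + 1))"
    have pos: "0 < norm g + 1" by (simp add: add_nonneg_pos)
    have r: "0 \<le> r" "r < 1" using \<epsilon> pos by (auto simp: r_def)
    have "norm g * (1 - r) \<le> norm g * (\<epsilon> / (norm g + 1))"
      by (intro mult_left_mono) (auto simp: r_def)
    also have "\<dots> \<le> \<epsilon>" using \<epsilon> pos by (simp add: field_simps)
    finally have gr: "norm g * (1 - r) \<le> \<epsilon>" .
    note lip = holo_lip_HL0_apply[of g]
    let ?h = "\<lambda>x. HL0_apply g (r *\<^sub>R x)"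
    have h: "holo_lip (norm g) ?h"
      using holo_lip_dilation[OF lip, of "\<lambda>x. x" 1 "of_real r"] r
      by (simp add: clinear_iff scaleC_of_real)
    have ball: "r *\<^sub>R x \<in> ball 0 1" if "x \<in> cball 0 1" for x :: 'a
    proof -
      have "r * norm x \<le> r" using r that by (simp add: mult_left_le)
      then show ?thesis using r by simp
    qed
    have close: "cmod (HL0_ext g (r *\<^sub>R x) - HL0_ext g x) \<le> \<epsilon>" if x: "x \<in> cball 0 1" for x
    proof -
      have "cmod (HL0_ext g (r *\<^sub>R x) - HL0_ext g x) \<le> norm g * norm (r *\<^sub>R x - x)"
        using ball[OF x] x ball_subset_cball by (intro lipschitz_on_normD[OF lipschitz_on_HL0_ext]) auto
      also have "r *\<^sub>R x - x = (r - 1) *\<^sub>R x" by (simp add: algebra_simps)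
      also have "norm g * norm ((r - 1) *\<^sub>R x) \<le> norm g * (1 - r)"
        using r x by (intro mult_left_mono) (auto simp: mult_left_le)
      finally show ?thesis using gr by simp
    qed
    have h0: "?h 0 = 0" by (simp add: HL0_apply_zero)
    have "cmod (HL0_apply (HL0_of ?h) x - HL0_apply g x) \<le> \<epsilon>" if "x \<in> K" for x
    proof -
      have x: "x \<in> ball 0 1" "x \<in> cball 0 1" using that K ball_subset_cball by auto
      show ?thesis
        using close[OF x(2)] x(1) ball[OF x(2)] h0
        by (simp add: HL0_apply_HL0_of[OF h] HL0_ext_def)
    qed
    moreover have "\<phi> (HL0_of ?h) = HL0_ext g (r *\<^sub>R x\<^sub>0)"
      using unital_extension_dilation[OF assms x0 bary lip, of "of_real r"] r ball[OF x0] h0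
      by (simp add: unital_extension_def HL0_ext_def scaleC_of_real)
    ultimately show "\<exists>h. norm h \<le> norm g \<and> (\<forall>x\<in>K. cmod (HL0_apply h x - HL0_apply g x) \<le> \<epsilon>) \<and>
        cmod (\<phi> h - delta x\<^sub>0 g) \<le> \<epsilon>"
      using norm_HL0_of_le[OF h] close[OF x0] x0
      by (intro exI[of _ "HL0_of ?h"]) (simp add: delta_apply)
  qed
  then have "\<phi> = delta x\<^sub>0" by (rule blinfun_eqI)
  then show ?thesis using x0 by blast
qed

end
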